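(* Let $M$ be a simple connected regular matroid, and let $e$ and $f$ be distinct elements of $M$. Suppose that every circuit of $M$ containing both $e$ and $f$ is spanning. Then $M\cong M(L)$ for some clean ladder $L$.
   Context: All matroids and graphs are finite. A circuit $C$ of a matroid $M$ is spanning if $r_M(C)=r(M)$. A matroid is regular if it is representable over every field. $M(L)$ denotes the cycle matroid of the graph $L$. Let $B_3$ denote the graph consisting of two vertices joined by three edges. A 2-sum of two graphs with basepoint $p$, where $p$ is the unique common edge of the two otherwise disjoint graphs, is obtained by identifying the two copies of $p$ (with their end-vertices identified, in either of the two possible ways) and then deleting the edge $p$. A graph $L$ is a clean ladder if it can be constructed, by taking successive 2-sums, via a path decomposition whose vertices are labeled, in order, by graphs $G_0,G_1,\dots,G_n$ ($n\ge 0$) where: (i) each $G_i$ is isomorphic to $K_4$, $K_3$, or $B_3$; (ii) each edge of the path is the basepoint of the 2-sum between its endpoints (so consecutive $G_{i-1}$, $G_i$ share exactly one edge, the basepoint $p_i$; non-consecutive ones share none; and for $0<i<n$ the two basepoints of $G_i$ are distinct edges of $G_i$); (iii) neither $G_0$ nor $G_n$ is isomorphic to $B_3$; (iv) no two consecutive vertices of the path are both isomorphic to $B_3$; and (v) whenever $0<i<n$ and $G_i\cong K_4$, the two edges of $G_i$ that are basepoints of 2-sums form a matching. (When $n=0$, $L=G_0$.) *)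

theory Defs
  imports "HOL-Algebra.Weak_Morphisms" "HOL-Algebra.Generated_Fields" "HOL-Library.Countable_Set"
begin

section \<open>Matroids\<close>

record 'e pre_matroid =
  ground :: "'e set"
  indep :: "'e set \<Rightarrow> bool"

locale matroid =
  fixes M :: "'e pre_matroid"
  assumes finite_ground: "finite (ground M)"
    and indep_subset_ground: "indep M X \<Longrightarrow> X \<subseteq> ground M"
    and indep_empty: "indep M {}"
    and indep_mono: "indep M Y \<Longrightarrow> X \<subseteq> Y \<Longrightarrow> indep M X"
    and indep_augment: "indep M X \<Longrightarrow> indep M Y \<Longrightarrow> card X < card Y \<Longrightarrow>
      \<exists>y\<in>Y - X. indep M (insert y X)"

definition circuit :: "'e pre_matroid \<Rightarrow> 'e set \<Rightarrow> bool" where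
  "circuit M C \<longleftrightarrow> C \<subseteq> ground M \<and> \<not> indep M C \<and> (\<forall>D. D \<subset> C \<longrightarrow> indep M D)"

definition rank :: "'e pre_matroid \<Rightarrow> 'e set \<Rightarrow> nat" where
  "rank M X = Max (card ` {Y. Y \<subseteq> X \<and> indep M Y})"

definition spanning :: "'e pre_matroid \<Rightarrow> 'e set \<Rightarrow> bool" where
  "spanning M X \<longleftrightarrow> X \<subseteq> ground M \<and> rank M X = rank M (ground M)"

text \<open>Circuits with one element are loops, circuits with two elements are parallel pairs.\<close>

definition simple_matroid :: "'e pre_matroid \<Rightarrow> bool" where
  "simple_matroid M \<longleftrightarrow> (\<forall>C. circuit M C \<longrightarrow> card C \<ge> 3)"

definition connected_matroid :: "'e pre_matroid \<Rightarrow> bool" where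
  "connected_matroid M \<longleftrightarrow>
    (\<forall>x\<in>ground M. \<forall>y\<in>ground M. x \<noteq> y \<longrightarrow> (\<exists>C. circuit M C \<and> x \<in> C \<and> y \<in> C))"

definition matroid_iso :: "'e pre_matroid \<Rightarrow> 'd pre_matroid \<Rightarrow> bool" where
  "matroid_iso M N \<longleftrightarrow> (\<exists>\<phi>. bij_betw \<phi> (ground M) (ground N) \<and>
    (\<forall>X. X \<subseteq> ground M \<longrightarrow> (indep M X \<longleftrightarrow> indep N (\<phi> ` X))))"


subsection \<open>Representability\<close>

text \<open>
  The columns of the matrix \<open>A\<close> (with \<open>m\<close> rows, and columns labelled by elements of the ground
  set) that are labelled by \<open>X\<close> are linearly independent as a family: equal columns with
  different labels are dependent.
\<close>

definition columns_indep ::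
    "('k, 'b) ring_scheme \<Rightarrow> nat \<Rightarrow> (nat \<Rightarrow> 'e \<Rightarrow> 'k) \<Rightarrow> 'e set \<Rightarrow> bool" where
  "columns_indep F m A X \<longleftrightarrow>
    (\<forall>c \<in> X \<rightarrow> carrier F.
      (\<forall>i<m. (\<Oplus>\<^bsub>F\<^esub>x\<in>X. c x \<otimes>\<^bsub>F\<^esub> A i x) = \<zero>\<^bsub>F\<^esub>) \<longrightarrow> (\<forall>x\<in>X. c x = \<zero>\<^bsub>F\<^esub>))"

definition representable :: "('k, 'b) ring_scheme \<Rightarrow> 'e pre_matroid \<Rightarrow> bool" where
  "representable F M \<longleftrightarrow>
    (\<exists>m A. (\<forall>i<m. \<forall>x\<in>ground M. A i x \<in> carrier F) \<and>
      (\<forall>X. X \<subseteq> ground M \<longrightarrow> (indep M X \<longleftrightarrow> columns_indep F m A X)))"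

text \<open>
  A matroid is regular if it is representable over every field. A formula cannot quantify over
  all types, so the definition lets \<open>F\<close> range over all fields whose carrier is a set of natural
  numbers, i.e. up to isomorphism over all countable fields. The theorem
  \<open>regular_matroid_representable\<close> below shows that nothing is lost: a finite matroid that is
  regular in this sense is representable over every field, on whatever type.
\<close>

definition regular_matroid :: "'e pre_matroid \<Rightarrow> bool" where
  "regular_matroid M \<longleftrightarrow> (\<forall>F :: nat ring. field F \<longrightarrow> representable F M)"

lemma (in field) eliminate:
  assumes "finite X" "y \<in> X" "a \<in> X \<rightarrow> carrier R" "b \<in> X \<rightarrow> carrier R" "c \<in> X \<rightarrow> carrier R"
    and "a y \<noteq> \<zero>"
  shows "(\<Oplus>x\<in>X - {y}. c x \<otimes> (b x \<ominus> b y \<otimes> inv a y \<otimes> a x)) =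
    (\<Oplus>x\<in>X. c x \<otimes> b x) \<ominus> b y \<otimes> inv a y \<otimes> (\<Oplus>x\<in>X. c x \<otimes> a x)"
proof -
  have ay: "a y \<in> Units R" using assms by (auto simp: field_Units)
  then have iy: "inv a y \<in> carrier R" by simp
  have by': "b y \<in> carrier R" "a y \<in> carrier R" "c y \<in> carrier R" using assms by auto
  define k where "k = \<ominus> (b y \<otimes> inv a y)"
  have k: "k \<in> carrier R" using iy by' by (simp add: k_def)
  have ck: "c x \<otimes> (b x \<ominus> b y \<otimes> inv a y \<otimes> a x) = c x \<otimes> b x \<oplus> k \<otimes> (c x \<otimes> a x)"
    and cl: "a x \<in> carrier R" "b x \<in> carrier R" "c x \<in> carrier R" if "x \<in> X" for x
  proof -
    show cl: "a x \<in> carrier R" "b x \<in> carrier R" "c x \<in> carrier R" using assms that by auto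
    show "c x \<otimes> (b x \<ominus> b y \<otimes> inv a y \<otimes> a x) = c x \<otimes> b x \<oplus> k \<otimes> (c x \<otimes> a x)"
      using cl by' iy by (simp add: k_def minus_eq r_distr l_minus r_minus m_ac)
  qed
  have zero: "c y \<otimes> (b y \<ominus> b y \<otimes> inv a y \<otimes> a y) = \<zero>"
    using by' iy ay by (simp add: m_assoc Units_l_inv minus_eq r_neg)
  have "(\<Oplus>x\<in>X. c x \<otimes> (b x \<ominus> b y \<otimes> inv a y \<otimes> a x)) =
      c y \<otimes> (b y \<ominus> b y \<otimes> inv a y \<otimes> a y) \<oplus>
      (\<Oplus>x\<in>X - {y}. c x \<otimes> (b x \<ominus> b y \<otimes> inv a y \<otimes> a x))"
    using assms(1,2) cl iy
    by (subst insert_Diff[OF assms(2), symmetric], subst finsum_insert) auto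
  then have "(\<Oplus>x\<in>X - {y}. c x \<otimes> (b x \<ominus> b y \<otimes> inv a y \<otimes> a x)) =
      (\<Oplus>x\<in>X. c x \<otimes> (b x \<ominus> b y \<otimes> inv a y \<otimes> a x))"
    unfolding zero using cl iy by' by (subst (asm) l_zero) (auto intro!: finsum_closed)
  also have "\<dots> = (\<Oplus>x\<in>X. c x \<otimes> b x \<oplus> k \<otimes> (c x \<otimes> a x))"
    using cl k by (intro finsum_cong') (auto simp: ck)
  also have "\<dots> = (\<Oplus>x\<in>X. c x \<otimes> b x) \<oplus> (\<Oplus>x\<in>X. k \<otimes> (c x \<otimes> a x))"
    using cl k by (intro finsum_addf) auto
  also have "(\<Oplus>x\<in>X. k \<otimes> (c x \<otimes> a x)) = k \<otimes> (\<Oplus>x\<in>X. c x \<otimes> a x)"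
    using cl k assms(1) by (intro finsum_rdistr[symmetric]) auto
  finally show ?thesis
    using cl by' iy by (simp add: k_def minus_eq l_minus)
qed

text \<open>Linear independence is preserved by field extensions.\<close>

lemma solution_descends:
  fixes N :: "('k, 'm) ring_scheme" and F :: "('l, 'n) ring_scheme" and m :: nat
  assumes N: "field N" and F: "field F" and h: "h \<in> ring_hom N F"
  assumes "finite X" "\<forall>i<m. \<forall>x\<in>X. A i x \<in> carrier N"
    and "c \<in> X \<rightarrow> carrier F" "\<exists>x\<in>X. c x \<noteq> \<zero>\<^bsub>F\<^esub>"
    and "\<forall>i<m. (\<Oplus>\<^bsub>F\<^esub>x\<in>X. c x \<otimes>\<^bsub>F\<^esub> h (A i x)) = \<zero>\<^bsub>F\<^esub>"
  shows "\<exists>d \<in> X \<rightarrow> carrier N. (\<exists>x\<in>X. d x \<noteq> \<zero>\<^bsub>N\<^esub>) \<and>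
    (\<forall>i<m. (\<Oplus>\<^bsub>N\<^esub>x\<in>X. d x \<otimes>\<^bsub>N\<^esub> A i x) = \<zero>\<^bsub>N\<^esub>)"
  using assms(4-)
proof (induction m arbitrary: A X)
  case 0
  interpret N: field N by fact
  have "X \<noteq> {}" using 0 by auto
  then show ?case by (intro bexI[where x = "\<lambda>_. \<one>\<^bsub>N\<^esub>"]) auto
next
  case (Suc m)
  interpret N: field N by fact
  interpret F: field F by fact
  interpret h: ring_hom_cring N F h
    by (intro ring_hom_cringI N.is_cring F.is_cring h)
  have A: "A i x \<in> carrier N" if "i \<le> m" "x \<in> X" for i x using Suc.prems that by auto
  have c: "c x \<in> carrier F" if "x \<in> X" for x using Suc.prems that by auto
  show ?case
  proof (cases "\<forall>x\<in>X. A m x = \<zero>\<^bsub>N\<^esub>")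
    case True
    have "\<exists>d \<in> X \<rightarrow> carrier N. (\<exists>x\<in>X. d x \<noteq> \<zero>\<^bsub>N\<^esub>) \<and>
        (\<forall>i<m. (\<Oplus>\<^bsub>N\<^esub>x\<in>X. d x \<otimes>\<^bsub>N\<^esub> A i x) = \<zero>\<^bsub>N\<^esub>)"
      using Suc.prems by (intro Suc.IH) auto
    then obtain d where d: "d \<in> X \<rightarrow> carrier N" "\<exists>x\<in>X. d x \<noteq> \<zero>\<^bsub>N\<^esub>"
      "\<forall>i<m. (\<Oplus>\<^bsub>N\<^esub>x\<in>X. d x \<otimes>\<^bsub>N\<^esub> A i x) = \<zero>\<^bsub>N\<^esub>" by blast
    have "(\<Oplus>\<^bsub>N\<^esub>x\<in>X. d x \<otimes>\<^bsub>N\<^esub> A m x) = (\<Oplus>\<^bsub>N\<^esub>x\<in>X. \<zero>\<^bsub>N\<^esub>)"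
      using d(1) True by (intro N.finsum_cong') (auto simp: Pi_iff)
    with d show ?thesis by (auto simp: less_Suc_eq)
  next
    case False
    then obtain y where y: "y \<in> X" "A m y \<noteq> \<zero>\<^bsub>N\<^esub>" by blast
    define a where "a = A m"
    have aU: "a y \<in> Units N" using y A[of m y] by (auto simp: N.field_Units a_def)
    have ay: "a y \<noteq> \<zero>\<^bsub>N\<^esub>" "a y \<in> carrier N" "inv\<^bsub>N\<^esub> a y \<in> carrier N"
      using y A[of m y] aU by (auto simp: a_def)
    have "h (a y) \<otimes>\<^bsub>F\<^esub> h (inv\<^bsub>N\<^esub> a y) = \<one>\<^bsub>F\<^esub>"
      using ay aU h.hom_mult[of "a y" "inv\<^bsub>N\<^esub> a y"] by (simp add: N.Units_r_inv)
    then have hinv: "inv\<^bsub>F\<^esub> (h (a y)) = h (inv\<^bsub>N\<^esub> a y)" and hay: "h (a y) \<noteq> \<zero>\<^bsub>F\<^esub>"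
      using ay by (auto intro!: F.inv_char simp: F.m_comm)
    define B where "B = (\<lambda>i x. A i x \<ominus>\<^bsub>N\<^esub> A i y \<otimes>\<^bsub>N\<^esub> inv\<^bsub>N\<^esub> a y \<otimes>\<^bsub>N\<^esub> a x)"
    have hB: "h (B i x) = h (A i x) \<ominus>\<^bsub>F\<^esub> h (A i y) \<otimes>\<^bsub>F\<^esub> inv\<^bsub>F\<^esub> (h (a y)) \<otimes>\<^bsub>F\<^esub> h (a x)"
      if "x \<in> X" "i \<le> m" for x i
      using that A[of i x] A[of i y] A[of m x] ay y
      by (simp add: B_def hinv[unfolded a_def] N.minus_eq F.minus_eq a_def)
    have "\<exists>d \<in> X - {y} \<rightarrow> carrier N. (\<exists>x\<in>X - {y}. d x \<noteq> \<zero>\<^bsub>N\<^esub>) \<and>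
        (\<forall>i<m. (\<Oplus>\<^bsub>N\<^esub>x\<in>X - {y}. d x \<otimes>\<^bsub>N\<^esub> B i x) = \<zero>\<^bsub>N\<^esub>)"
    proof (rule Suc.IH)
      show "finite (X - {y})" "c \<in> X - {y} \<rightarrow> carrier F" using Suc.prems by auto
      show "\<forall>i<m. \<forall>x\<in>X - {y}. B i x \<in> carrier N"
        using A ay y by (auto simp: B_def a_def)
      show "\<exists>x\<in>X - {y}. c x \<noteq> \<zero>\<^bsub>F\<^esub>"
      proof (rule ccontr)
        assume "\<not> ?thesis"
        then have z: "\<And>x. x \<in> X - {y} \<Longrightarrow> c x = \<zero>\<^bsub>F\<^esub>" by blast
        have "(\<Oplus>\<^bsub>F\<^esub>x\<in>X. c x \<otimes>\<^bsub>F\<^esub> h (a x)) =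
            c y \<otimes>\<^bsub>F\<^esub> h (a y) \<oplus>\<^bsub>F\<^esub> (\<Oplus>\<^bsub>F\<^esub>x\<in>X - {y}. c x \<otimes>\<^bsub>F\<^esub> h (a x))"
          using Suc.prems(1) y c A
          by (subst insert_Diff[OF y(1), symmetric], subst F.finsum_insert) (auto simp: a_def)
        also have "(\<Oplus>\<^bsub>F\<^esub>x\<in>X - {y}. c x \<otimes>\<^bsub>F\<^esub> h (a x)) = (\<Oplus>\<^bsub>F\<^esub>x\<in>X - {y}. \<zero>\<^bsub>F\<^esub>)"
          using A by (intro F.finsum_cong') (auto simp: z a_def)
        finally have "c y \<otimes>\<^bsub>F\<^esub> h (a y) = \<zero>\<^bsub>F\<^esub>"
          using Suc.prems(5) c y ay by (auto simp: a_def)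
        then have "c y = \<zero>\<^bsub>F\<^esub>" using hay c y ay F.integral[of "c y" "h (a y)"] by auto
        then show False using z Suc.prems(4) by blast
      qed
      show "\<forall>i<m. (\<Oplus>\<^bsub>F\<^esub>x\<in>X - {y}. c x \<otimes>\<^bsub>F\<^esub> h (B i x)) = \<zero>\<^bsub>F\<^esub>"
      proof (intro allI impI)
        fix i assume i: "i < m"
        have "(\<Oplus>\<^bsub>F\<^esub>x\<in>X - {y}. c x \<otimes>\<^bsub>F\<^esub> h (B i x)) =
            (\<Oplus>\<^bsub>F\<^esub>x\<in>X - {y}. c x \<otimes>\<^bsub>F\<^esub>
              (h (A i x) \<ominus>\<^bsub>F\<^esub> h (A i y) \<otimes>\<^bsub>F\<^esub> inv\<^bsub>F\<^esub> (h (a y)) \<otimes>\<^bsub>F\<^esub> h (a x)))"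
          using i A c ay y by (intro F.finsum_cong') (auto simp: hB hinv[unfolded a_def] a_def)
        also have "\<dots> = (\<Oplus>\<^bsub>F\<^esub>x\<in>X. c x \<otimes>\<^bsub>F\<^esub> h (A i x)) \<ominus>\<^bsub>F\<^esub>
            h (A i y) \<otimes>\<^bsub>F\<^esub> inv\<^bsub>F\<^esub> (h (a y)) \<otimes>\<^bsub>F\<^esub> (\<Oplus>\<^bsub>F\<^esub>x\<in>X. c x \<otimes>\<^bsub>F\<^esub> h (a x))"
          using i A c y hay Suc.prems(1)
          by (intro F.eliminate[of X y "\<lambda>x. h (a x)" "\<lambda>x. h (A i x)"]) (auto simp: a_def)
        also have "\<dots> = \<zero>\<^bsub>F\<^esub>"
          using i Suc.prems(5) A[of i y] y ay by (simp add: a_def hinv[unfolded a_def] F.minus_eq)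
        finally show "(\<Oplus>\<^bsub>F\<^esub>x\<in>X - {y}. c x \<otimes>\<^bsub>F\<^esub> h (B i x)) = \<zero>\<^bsub>F\<^esub>" .
      qed
    qed
    then obtain d where d: "d \<in> X - {y} \<rightarrow> carrier N" "\<exists>x\<in>X - {y}. d x \<noteq> \<zero>\<^bsub>N\<^esub>"
      "\<forall>i<m. (\<Oplus>\<^bsub>N\<^esub>x\<in>X - {y}. d x \<otimes>\<^bsub>N\<^esub> B i x) = \<zero>\<^bsub>N\<^esub>" by blast
    define s where "s = (\<Oplus>\<^bsub>N\<^esub>x\<in>X - {y}. d x \<otimes>\<^bsub>N\<^esub> a x)"
    have s: "s \<in> carrier N" unfolding s_def using d(1) A by (auto intro!: N.finsum_closed simp: a_def Pi_iff)
    define d' where "d' = d(y := \<ominus>\<^bsub>N\<^esub> (s \<otimes>\<^bsub>N\<^esub> inv\<^bsub>N\<^esub> a y))"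
    have d': "d' x \<in> carrier N" if "x \<in> X" for x using that d(1) s ay by (auto simp: d'_def)
    have "(\<Oplus>\<^bsub>N\<^esub>x\<in>X. d' x \<otimes>\<^bsub>N\<^esub> a x) =
        d' y \<otimes>\<^bsub>N\<^esub> a y \<oplus>\<^bsub>N\<^esub> (\<Oplus>\<^bsub>N\<^esub>x\<in>X - {y}. d' x \<otimes>\<^bsub>N\<^esub> a x)"
      using Suc.prems(1) y d' A
      by (subst insert_Diff[OF y(1), symmetric], subst N.finsum_insert) (auto simp: a_def)
    also have "(\<Oplus>\<^bsub>N\<^esub>x\<in>X - {y}. d' x \<otimes>\<^bsub>N\<^esub> a x) = s"
      unfolding s_def using d(1) A by (intro N.finsum_cong') (auto simp: d'_def a_def Pi_iff)
    also have "d' y \<otimes>\<^bsub>N\<^esub> a y = \<ominus>\<^bsub>N\<^esub> s"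
      using s ay aU by (simp add: d'_def N.l_minus N.m_assoc N.Units_l_inv)
    finally have sum_a: "(\<Oplus>\<^bsub>N\<^esub>x\<in>X. d' x \<otimes>\<^bsub>N\<^esub> a x) = \<zero>\<^bsub>N\<^esub>" using s by (simp add: N.l_neg)
    have "(\<Oplus>\<^bsub>N\<^esub>x\<in>X. d' x \<otimes>\<^bsub>N\<^esub> A i x) = \<zero>\<^bsub>N\<^esub>" if i: "i < m" for i
    proof -
      have "(\<Oplus>\<^bsub>N\<^esub>x\<in>X - {y}. d x \<otimes>\<^bsub>N\<^esub> B i x) = (\<Oplus>\<^bsub>N\<^esub>x\<in>X - {y}. d' x \<otimes>\<^bsub>N\<^esub> B i x)"
        using i A ay y d(1) by (intro N.finsum_cong') (auto simp: d'_def B_def a_def Pi_iff)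
      also have "\<dots> = (\<Oplus>\<^bsub>N\<^esub>x\<in>X. d' x \<otimes>\<^bsub>N\<^esub> A i x) \<ominus>\<^bsub>N\<^esub>
            A i y \<otimes>\<^bsub>N\<^esub> inv\<^bsub>N\<^esub> a y \<otimes>\<^bsub>N\<^esub> (\<Oplus>\<^bsub>N\<^esub>x\<in>X. d' x \<otimes>\<^bsub>N\<^esub> a x)"
        unfolding B_def using i A d' y ay Suc.prems(1)
        by (intro N.eliminate[of X y a "A i"]) (auto simp: a_def)
      also have "\<dots> = (\<Oplus>\<^bsub>N\<^esub>x\<in>X. d' x \<otimes>\<^bsub>N\<^esub> A i x)"
        using i A d' y ay by (simp add: sum_a N.minus_eq)
      finally show ?thesis using d(3) i by simp
    qed
    moreover have "\<exists>x\<in>X. d' x \<noteq> \<zero>\<^bsub>N\<^esub>" using d(2) by (auto simp: d'_def)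
    ultimately show ?thesis
      using d' sum_a by (intro bexI[of _ d']) (auto simp: less_Suc_eq a_def)
  qed
qed

lemma columns_indep_hom:
  fixes N :: "('k, 'm) ring_scheme" and F :: "('l, 'n) ring_scheme" and m :: nat
  assumes N: "field N" and F: "field F" and h: "h \<in> ring_hom N F"
    and X: "finite X" and A: "\<forall>i<m. \<forall>x\<in>X. A i x \<in> carrier N"
  shows "columns_indep F m (\<lambda>i x. h (A i x)) X \<longleftrightarrow> columns_indep N m A X"
proof
  interpret N: field N by fact
  interpret F: field F by fact
  interpret h: ring_hom_cring N F h
    by (intro ring_hom_cringI N.is_cring F.is_cring h)
  assume ind: "columns_indep F m (\<lambda>i x. h (A i x)) X"
  show "columns_indep N m A X"
    unfolding columns_indep_def
  proof (intro ballI impI)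
    fix c x
    assume c: "c \<in> X \<rightarrow> carrier N" and s: "\<forall>i<m. (\<Oplus>\<^bsub>N\<^esub>x\<in>X. c x \<otimes>\<^bsub>N\<^esub> A i x) = \<zero>\<^bsub>N\<^esub>"
      and x: "x \<in> X"
    have "(\<Oplus>\<^bsub>F\<^esub>x\<in>X. h (c x) \<otimes>\<^bsub>F\<^esub> h (A i x)) = \<zero>\<^bsub>F\<^esub>" if i: "i < m" for i
    proof -
      have "(\<Oplus>\<^bsub>F\<^esub>x\<in>X. h (c x) \<otimes>\<^bsub>F\<^esub> h (A i x)) = (\<Oplus>\<^bsub>F\<^esub>x\<in>X. h (c x \<otimes>\<^bsub>N\<^esub> A i x))"
        using c A i by (intro F.finsum_cong') (auto simp: Pi_iff)
      also have "\<dots> = h (\<Oplus>\<^bsub>N\<^esub>x\<in>X. c x \<otimes>\<^bsub>N\<^esub> A i x)"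
        using c A i by (subst h.hom_finsum) (auto simp: Pi_iff o_def)
      finally show ?thesis using s i by simp
    qed
    moreover have "(\<lambda>x. h (c x)) \<in> X \<rightarrow> carrier F" using c by auto
    ultimately have "h (c x) = \<zero>\<^bsub>F\<^esub>"
      using ind[unfolded columns_indep_def, rule_format, of "\<lambda>x. h (c x)" x] x by simp
    moreover have "inj_on h (carrier N)"
    proof (rule h.ring.non_trivial_field_hom_imp_inj[OF N])
      have "\<one>\<^bsub>F\<^esub> \<in> h ` carrier N" using imageI[OF N.one_closed, of h] by simp
      then show "h ` carrier N \<noteq> {\<zero>\<^bsub>F\<^esub>}" using F.one_not_zero by blast
    qed
    ultimately show "c x = \<zero>\<^bsub>N\<^esub>" using c x inj_onD[of h "carrier N" "c x" "\<zero>\<^bsub>N\<^esub>"] by auto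
  qed
next
  assume ind: "columns_indep N m A X"
  show "columns_indep F m (\<lambda>i x. h (A i x)) X"
  proof (rule ccontr)
    assume "\<not> ?thesis"
    then obtain c where "c \<in> X \<rightarrow> carrier F" "\<exists>x\<in>X. c x \<noteq> \<zero>\<^bsub>F\<^esub>"
      "\<forall>i<m. (\<Oplus>\<^bsub>F\<^esub>x\<in>X. c x \<otimes>\<^bsub>F\<^esub> h (A i x)) = \<zero>\<^bsub>F\<^esub>"
      unfolding columns_indep_def by blast
    from solution_descends[OF N F h X A this] ind show False
      unfolding columns_indep_def by blast
  qed
qed

lemma (in field) countable_prime_subfield: "countable (generate_field R {})"
proof -
  define step where "step = (\<lambda>S. S \<union> {\<one>} \<union> (\<lambda>x. \<ominus> x) ` S \<union> (\<lambda>x. inv x) ` S \<union>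
    (\<lambda>(x, y). x \<oplus> y) ` (S \<times> S) \<union> (\<lambda>(x, y). x \<otimes> y) ` (S \<times> S))"
  define T where "T = (\<lambda>n. (step ^^ n) {})"
  have T_Suc: "T (Suc n) = step (T n)" for n by (simp add: T_def)
  have "countable (T n)" for n
    by (induction n) (auto simp: T_def step_def)
  moreover have "incseq T"
    by (rule incseq_SucI) (auto simp: T_Suc step_def)
  then have le: "T n \<subseteq> T (max n k)" "T k \<subseteq> T (max n k)" for n k
    by (auto simp: incseq_def)
  have "x \<in> (\<Union>n. T n)" if "x \<in> generate_field R {}" for x
    using that
  proof (induction rule: generate_field.induct)
    case one
    have "\<one> \<in> T (Suc 0)" by (simp only: T_Suc) (simp add: step_def)
    then show ?case by blast
  next
    case (a_inv x)
    then obtain n where "x \<in> T n" by blast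
    then have "\<ominus> x \<in> T (Suc n)" by (simp only: T_Suc) (simp add: step_def)
    then show ?case by blast
  next
    case (m_inv x)
    then obtain n where "x \<in> T n" by blast
    then have "inv x \<in> T (Suc n)" by (simp only: T_Suc) (simp add: step_def)
    then show ?case by blast
  next
    case (eng_add x y)
    then obtain n k where "x \<in> T n" "y \<in> T k" by blast
    then have "x \<in> T (max n k)" "y \<in> T (max n k)" using le by blast+
    then have "x \<oplus> y \<in> T (Suc (max n k))" by (simp only: T_Suc) (force simp: step_def)
    then show ?case by blast
  next
    case (eng_mult x y)
    then obtain n k where "x \<in> T n" "y \<in> T k" by blast
    then have "x \<in> T (max n k)" "y \<in> T (max n k)" using le by blast+
    then have "x \<otimes> y \<in> T (Suc (max n k))" by (simp only: T_Suc) (force simp: step_def)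
    then show ?case by blast
  qed simp
  then have "generate_field R {} \<subseteq> (\<Union>n. T n)" by blast
  ultimately show ?thesis by (meson countable_UN countable_subset countableI_type)
qed

theorem regular_matroid_representable:
  fixes F :: "('k, 'b) ring_scheme"
  assumes M: "matroid M" and reg: "regular_matroid M" and F: "field F"
  shows "representable F M"
proof -
  interpret F: field F by fact
  define P where "P = F\<lparr>carrier := generate_field F {}\<rparr>"
  have P: "field P" unfolding P_def by (rule F.generate_field_is_field) simp
  interpret P: field P by fact
  have "countable (carrier P)" by (simp add: P_def F.countable_prime_subfield)
  then obtain g :: "'k \<Rightarrow> nat" where g: "inj_on g (carrier P)" by (auto simp: countable_def)
  define N where "N = image_ring g P"
  have N: "field N" unfolding N_def by (rule P.inj_imp_image_ring_is_field[OF g])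
  have "P \<simeq> N"
    unfolding N_def using inj_imp_image_ring_iso[OF g] by (auto simp: is_ring_iso_def)
  then have "N \<simeq> P" by (rule ring_iso_sym[OF P.ring_axioms])
  then obtain h where "h \<in> ring_iso N P" by (auto simp: is_ring_iso_def)
  moreover have "ring_hom N P \<subseteq> ring_hom N F"
    using F.generate_field_incl[of "{}"] by (auto simp: ring_hom_def P_def)
  ultimately have h: "h \<in> ring_hom N F" unfolding ring_iso_def by blast
  have "representable N M" using reg N by (simp add: regular_matroid_def)
  then obtain m A where A: "\<forall>i<m. \<forall>x\<in>ground M. A i x \<in> carrier N"
    and rep: "\<forall>X. X \<subseteq> ground M \<longrightarrow> (indep M X \<longleftrightarrow> columns_indep N m A X)"
    unfolding representable_def by (elim exE conjE)
  have "indep M X \<longleftrightarrow> columns_indep F m (\<lambda>i x. h (A i x)) X" if X: "X \<subseteq> ground M" for X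
  proof -
    have "finite X" using matroid.finite_ground[OF M] X by (rule rev_finite_subset)
    then show ?thesis
      using columns_indep_hom[OF N F h, of X m A] A X rep by (simp add: subset_iff)
  qed
  moreover have "\<forall>i<m. \<forall>x\<in>ground M. h (A i x) \<in> carrier F"
    using A h by (auto simp: ring_hom_def)
  ultimately show ?thesis
    unfolding representable_def by (intro exI[of _ m] exI[of _ "\<lambda>i x. h (A i x)"]) simp
qed


section \<open>Graphs\<close>

text \<open>
  Finite undirected graphs; parallel edges and loops are allowed. A loop has one end, every other
  edge has two.
\<close>

record ('v, 'e) pre_graph =
  verts :: "'v set"
  edges :: "'e set"
  ends :: "'e \<Rightarrow> 'v set"

locale graph =
  fixes G :: "('v, 'e) pre_graph"
  assumes finite_verts: "finite (verts G)"
    and finite_edges: "finite (edges G)"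
    and ends_subset: "x \<in> edges G \<Longrightarrow> ends G x \<subseteq> verts G"
    and card_ends: "x \<in> edges G \<Longrightarrow> card (ends G x) \<in> {1, 2}"

definition graph_iso :: "('v, 'e) pre_graph \<Rightarrow> ('w, 'd) pre_graph \<Rightarrow> bool" where
  "graph_iso G H \<longleftrightarrow> (\<exists>\<phi> \<psi>. bij_betw \<phi> (verts G) (verts H) \<and> bij_betw \<psi> (edges G) (edges H) \<and>
    (\<forall>x\<in>edges G. ends H (\<psi> x) = \<phi> ` ends G x))"

text \<open>
  \<open>X\<close> is the edge set of a cycle with vertices \<open>vs\<close> and edges \<open>es\<close> in cyclic order. A loop is a
  cycle of length 1, two parallel edges form a cycle of length 2.
\<close>

definition cycle :: "('v, 'e) pre_graph \<Rightarrow> 'e set \<Rightarrow> bool" where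
  "cycle G X \<longleftrightarrow> (\<exists>vs es. es \<noteq> [] \<and> length vs = length es \<and> distinct vs \<and> distinct es \<and>
    set vs \<subseteq> verts G \<and> set es \<subseteq> edges G \<and> set es = X \<and>
    (\<forall>i<length es. ends G (es ! i) = {vs ! i, vs ! (Suc i mod length vs)}))"

definition cycle_matroid :: "('v, 'e) pre_graph \<Rightarrow> 'e pre_matroid" where
  "cycle_matroid G =
    \<lparr>ground = edges G, indep = (\<lambda>X. X \<subseteq> edges G \<and> \<not> (\<exists>C\<subseteq>X. cycle G C))\<rparr>"

definition complete_graph :: "nat \<Rightarrow> (nat, nat set) pre_graph" where
  "complete_graph n = \<lparr>verts = {..<n}, edges = {e. e \<subseteq> {..<n} \<and> card e = 2}, ends = (\<lambda>e. e)\<rparr>"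

definition B3 :: "(nat, nat) pre_graph" where
  "B3 = \<lparr>verts = {0, 1}, edges = {0, 1, 2}, ends = (\<lambda>_. {0, 1})\<rparr>"


subsection \<open>2-sums and clean ladders\<close>

text \<open>
  \<open>H\<close> is a 2-sum of \<open>G\<^sub>1\<close> and \<open>G\<^sub>2\<close> with basepoint \<open>p\<close>. The renaming \<open>\<phi>\<close> of the vertices of \<open>G\<^sub>2\<close>
  carries the ends of \<open>p\<close> in \<open>G\<^sub>2\<close> to the ends of \<open>p\<close> in \<open>G\<^sub>1\<close>, in either of the two possible ways,
  and makes all other vertices of \<open>G\<^sub>2\<close> disjoint from those of \<open>G\<^sub>1\<close>. In particular it is
  irrelevant whether \<open>G\<^sub>1\<close> and \<open>G\<^sub>2\<close> have vertex names in common.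
\<close>

definition two_sum ::
    "'e \<Rightarrow> ('v, 'e) pre_graph \<Rightarrow> ('v, 'e) pre_graph \<Rightarrow> ('v, 'e) pre_graph \<Rightarrow> bool" where
  "two_sum p G\<^sub>1 G\<^sub>2 H \<longleftrightarrow>
    edges G\<^sub>1 \<inter> edges G\<^sub>2 = {p} \<and>
    (\<exists>\<phi>. inj_on \<phi> (verts G\<^sub>2) \<and> \<phi> ` ends G\<^sub>2 p = ends G\<^sub>1 p \<and>
      verts G\<^sub>1 \<inter> \<phi> ` verts G\<^sub>2 = ends G\<^sub>1 p \<and>
      H = \<lparr>verts = verts G\<^sub>1 \<union> \<phi> ` verts G\<^sub>2,
           edges = (edges G\<^sub>1 \<union> edges G\<^sub>2) - {p},
           ends = (\<lambda>x. if x \<in> edges G\<^sub>1 then ends G\<^sub>1 x else \<phi> ` ends G\<^sub>2 x)\<rparr>)"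

text \<open>
  The path is \<open>G 0, \<dots>, G n\<close>, the basepoint between \<open>G (i - 1)\<close> and \<open>G i\<close> is \<open>p i\<close>, and \<open>H i\<close> is the
  graph built from \<open>G 0, \<dots>, G i\<close>. The labels are taken on the infinite type of natural
  numbers, so that there are always enough fresh edges to serve as basepoints; the resulting
  graph \<open>L\<close> is identified up to isomorphism and may live on any type.
\<close>

definition clean_ladder :: "('v, 'e) pre_graph \<Rightarrow> bool" where
  "clean_ladder L \<longleftrightarrow> graph L \<and>
    (\<exists>(n :: nat) (G :: nat \<Rightarrow> (nat, nat) pre_graph) (p :: nat \<Rightarrow> nat)
       (H :: nat \<Rightarrow> (nat, nat) pre_graph).
      (\<forall>i\<le>n. graph (G i) \<and>
        (graph_iso (G i) (complete_graph 4) \<or> graph_iso (G i) (complete_graph 3) \<or>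
         graph_iso (G i) B3)) \<and>
      (\<forall>i\<in>{1..n}. edges (G (i - 1)) \<inter> edges (G i) = {p i}) \<and>
      (\<forall>i j. i + 1 < j \<and> j \<le> n \<longrightarrow> edges (G i) \<inter> edges (G j) = {}) \<and>
      (\<forall>i. 0 < i \<and> i < n \<longrightarrow> p i \<noteq> p (i + 1)) \<and>
      \<not> graph_iso (G 0) B3 \<and> \<not> graph_iso (G n) B3 \<and>
      (\<forall>i\<in>{1..n}. \<not> (graph_iso (G (i - 1)) B3 \<and> graph_iso (G i) B3)) \<and>
      (\<forall>i. 0 < i \<and> i < n \<and> graph_iso (G i) (complete_graph 4) \<longrightarrow>
        ends (G i) (p i) \<inter> ends (G i) (p (i + 1)) = {}) \<and>
      H 0 = G 0 \<and>
      (\<forall>i\<in>{1..n}. two_sum (p i) (H (i - 1)) (G i) (H i)) \<and>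
      graph_iso L (H n))"

end

theory Submission
  imports Defs "HOL-Library.Z2"
begin

text \<open>
  By connectivity some circuit \<open>C\<close> contains \<open>e\<close> and \<open>f\<close>, and it is spanning. Over GF(2) every
  \<open>z\<close> outside \<open>C\<close> is a chord: it splits \<open>C\<close> into two parts that form circuits with \<open>z\<close>, and by
  the hypothesis these parts separate \<open>e\<close> from \<open>f\<close>. Let \<open>chord z\<close> be the part containing \<open>e\<close>.
  If \<open>chord z\<close> and \<open>chord w\<close> are incomparable, then \<open>{z, w}\<close> together with the elements of \<open>C\<close> outside
  their symmetric difference is a circuit through \<open>e\<close> and \<open>f\<close>, so the symmetric difference has
  size 2. Three chords on the same level would give a Fano minor, which a representation over the
  rationals excludes. Hence the elements of \<open>C\<close> other than \<open>e\<close> and \<open>f\<close> can be ordered as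
  \<open>x\<^sub>0, x\<^sub>1, \<dots>\<close> such that every \<open>chord z - {e}\<close> is \<open>{x\<^sub>0, \<dots>, x\<^sub>j\<^sub>-\<^sub>1}\<close> or
  \<open>{x\<^sub>0, \<dots>, x\<^sub>i\<^sub>-\<^sub>1, x\<^sub>i\<^sub>+\<^sub>1}\<close>.

  The ladder is drawn on the vertices \<open>0, \<dots>, m + 1\<close>, with \<open>C\<close> as the Hamiltonian cycle formed by
  \<open>e = {0, 1}\<close>, \<open>x\<^sub>i = {i, i + 2}\<close> and \<open>f = {m, m + 1}\<close>. A chord of the first kind is \<open>{j, j + 1}\<close>
  and one of the second kind is \<open>{i, i + 3}\<close>; the latter is one of two crossing chords of a
  \<open>K\<^sub>4\<close>.
\<close>

section \<open>Binary and rational representations\<close>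

text \<open>Presents a field given by a type class as a ring record, so that the general
  representability theorem can be applied to \<open>bit\<close> and to \<open>rat\<close>.\<close>

definition field_ring :: "'a::field ring" where
  "field_ring = \<lparr>carrier = UNIV, mult = (*), one = 1, zero = 0, add = (+)\<rparr>"

lemma field_field_ring: "field (field_ring :: 'a::field ring)"
proof -
  have "\<exists>y. y + x = 0 \<and> x + y = 0" for x :: 'a
    by (rule exI[of _ "- x"]) simp
  moreover have "\<exists>y. y * x = 1 \<and> x * y = 1" if "x \<noteq> 0" for x :: 'a
    by (rule exI[of _ "inverse x"]) (use that in simp)
  ultimately show ?thesis
    by (intro cring.cring_fieldI2 cringI abelian_groupI comm_monoidI)
       (auto simp: field_ring_def algebra_simps)
qed

lemma finsum_field_ring: "finite X \<Longrightarrow> finsum field_ring g X = sum g X"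
proof (induction X rule: finite_induct)
  case empty
  interpret field field_ring by (rule field_field_ring)
  show ?case using finsum_empty by (simp add: field_ring_def)
next
  case (insert x X)
  interpret field field_ring by (rule field_field_ring)
  show ?case using insert finsum_insert[of X x g] by (simp add: field_ring_def)
qed

text \<open>The counterpart of \<open>columns_indep\<close> for type-class fields. Rows are indexed
  by all natural numbers; a finite matrix is padded with zero rows.\<close>

definition lin_indep :: "(nat \<Rightarrow> 'e \<Rightarrow> 'a::field) \<Rightarrow> 'e set \<Rightarrow> bool" where
  "lin_indep A X \<longleftrightarrow> (\<forall>c. (\<forall>i. (\<Sum>x\<in>X. c x * A i x) = 0) \<longrightarrow> (\<forall>x\<in>X. c x = 0))"

text \<open>The field type stays open because two instances serve different purposes: over
  \<open>bit\<close> a linear relation is just a set, while over \<open>rat\<close> the number 2 is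
  nonzero, which excludes the Fano configuration.\<close>

lemma regular_matroid_lin_indep:
  assumes "matroid M" "regular_matroid M"
  obtains A :: "nat \<Rightarrow> 'e \<Rightarrow> 'a::field" where
    "\<And>X. X \<subseteq> ground M \<Longrightarrow> indep M X \<longleftrightarrow> lin_indep A X"
proof -
  have "representable (field_ring :: 'a ring) M"
    using assms field_field_ring by (rule regular_matroid_representable)
  then obtain m and A :: "nat \<Rightarrow> 'e \<Rightarrow> 'a" where
    A: "\<And>X. X \<subseteq> ground M \<Longrightarrow> indep M X \<longleftrightarrow> columns_indep field_ring m A X"
    unfolding representable_def by blast
  \<comment> \<open>The added zero rows impose only the trivial equation 0 = 0.\<close>
  have "indep M X \<longleftrightarrow> lin_indep (\<lambda>i x. if i < m then A i x else 0) X" if X: "X \<subseteq> ground M" for X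
  proof -
    have fin: "finite X" using X matroid.finite_ground[OF assms(1)] by (rule finite_subset)
    have *: "(\<forall>i. (\<Sum>x\<in>X. c x * (if i < m then A i x else 0)) = 0) \<longleftrightarrow>
        (\<forall>i<m. (\<Sum>x\<in>X. c x * A i x) = 0)" for c
    proof -
      have "(\<Sum>x\<in>X. c x * (if i < m then A i x else 0)) = (if i < m then \<Sum>x\<in>X. c x * A i x else 0)"
        for i by simp
      then show ?thesis by presburger
    qed
    show ?thesis
      unfolding A[OF X] columns_indep_def lin_indep_def *
      using fin by (simp add: finsum_field_ring) (simp add: field_ring_def)
  qed
  then show ?thesis by (rule that)
qed

text \<open>The kernel of \<open>A\<close> over GF(2), with vectors identified with their
  supports.\<close>

definition cycle_space :: "'e set \<Rightarrow> ('i \<Rightarrow> 'e \<Rightarrow> bit) \<Rightarrow> 'e set set" where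
  "cycle_space E A = {D. D \<subseteq> E \<and> (\<forall>i. (\<Sum>x\<in>D. A i x) = 0)}"

text \<open>Elements of the intersection are counted twice on the right and cancel in GF(2).\<close>

lemma sum_sym_diff_bit:
  fixes g :: "'e \<Rightarrow> bit"
  assumes "finite A" "finite B"
  shows "sum g (sym_diff A B) = sum g A + sum g B"
proof -
  have "sum g A = sum g (A \<inter> B) + sum g (A - B)" "sum g B = sum g (B \<inter> A) + sum g (B - A)"
    by (rule sum.Int_Diff[OF assms(1)], rule sum.Int_Diff[OF assms(2)])
  moreover have "sum g (sym_diff A B) = sum g (A - B) + sum g (B - A)"
    using assms by (intro sum.union_disjoint) auto
  moreover have "(q + p) + (q + r) = p + r" for p q r :: bit
    by (cases p; cases q; cases r) simp_all
  ultimately show ?thesis by (simp only: Int_commute)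
qed

lemma cycle_space_subset: "D \<in> cycle_space E A \<Longrightarrow> D \<subseteq> E"
  by (simp add: cycle_space_def)

lemma cycle_space_sym_diff:
  assumes "finite E" "D \<in> cycle_space E A" "D' \<in> cycle_space E A"
  shows "sym_diff D D' \<in> cycle_space E A"
proof -
  have "finite D" "finite D'" using assms by (auto simp: cycle_space_def intro: finite_subset)
  then show ?thesis using assms unfolding cycle_space_def
    by (auto simp only: mem_Collect_eq sum_sym_diff_bit add_0)
qed

text \<open>Over GF(2) a coefficient function is the indicator of its support, so the nontrivial
  relations among the columns of \<open>X\<close> are the nonempty kernel sets inside
  \<open>X\<close>.\<close>

lemma lin_indep_bit_iff:
  assumes "finite E" "X \<subseteq> E"
  shows "lin_indep A X \<longleftrightarrow> (\<forall>D\<in>cycle_space E A. D \<subseteq> X \<longrightarrow> D = {})"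
proof
  assume ind: "lin_indep A X"
  show "\<forall>D\<in>cycle_space E A. D \<subseteq> X \<longrightarrow> D = {}"
  proof (intro ballI impI)
    fix D assume D: "D \<in> cycle_space E A" "D \<subseteq> X"
    have "(\<Sum>x\<in>X. of_bool (x \<in> D) * A i x) = (\<Sum>x\<in>D. A i x)" for i
      using D(2) assms by (intro sum.mono_neutral_cong_right) (auto intro: finite_subset)
    then have "\<forall>i. (\<Sum>x\<in>X. of_bool (x \<in> D) * A i x) = 0"
      using D(1) by (auto simp only: cycle_space_def mem_Collect_eq)
    then have "\<forall>x\<in>X. (of_bool (x \<in> D) :: bit) = 0"
      by (rule ind[unfolded lin_indep_def, THEN spec, THEN mp])
    then show "D = {}" using D(2) by auto
  qed
next
  assume D: "\<forall>D\<in>cycle_space E A. D \<subseteq> X \<longrightarrow> D = {}"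
  show "lin_indep A X"
    unfolding lin_indep_def
  proof (intro allI impI)
    fix c assume c: "\<forall>i. (\<Sum>x\<in>X. c x * A i x) = 0"
    have "(\<Sum>x\<in>{x \<in> X. c x = 1}. A i x) = (\<Sum>x\<in>X. c x * A i x)" for i
      using assms by (intro sum.mono_neutral_cong_left) (auto intro: finite_subset)
    then have "{x \<in> X. c x = 1} \<in> cycle_space E A"
      using c assms by (auto simp: cycle_space_def)
    then have "{x \<in> X. c x = 1} = {}" by (rule D[THEN bspec, THEN mp]) simp
    then show "\<forall>x\<in>X. c x = 0" by (intro ballI bit_not_one_iff[THEN iffD1]) blast
  qed
qed

text \<open>If the dependent sets are those that contain a nonempty member of \<open>Z\<close>, then
  the minimal dependent sets are the minimal nonempty members.\<close>

lemma circuit_iff_minimal: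
  assumes ind: "\<And>X. X \<subseteq> ground M \<Longrightarrow> indep M X \<longleftrightarrow> (\<forall>D\<in>Z. D \<subseteq> X \<longrightarrow> D = {})"
    and Z: "\<And>D. D \<in> Z \<Longrightarrow> D \<subseteq> ground M"
  shows "circuit M C \<longleftrightarrow> C \<in> Z \<and> C \<noteq> {} \<and> (\<forall>D\<in>Z. D \<subset> C \<longrightarrow> D = {})"
proof
  assume C: "circuit M C"
  then have sub: "C \<subseteq> ground M" and "\<not> indep M C" by (simp_all add: circuit_def)
  then obtain D where D: "D \<in> Z" "D \<subseteq> C" "D \<noteq> {}" using ind[OF sub] by blast
  have min: "D = {}" if "D \<in> Z" "D \<subset> C" for D
  proof -
    have "indep M D" "D \<subseteq> ground M" using C that by (auto simp: circuit_def)
    then show ?thesis using ind[of D] that by blast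
  qed
  then have "D = C" using D by blast
  then show "C \<in> Z \<and> C \<noteq> {} \<and> (\<forall>D\<in>Z. D \<subset> C \<longrightarrow> D = {})" using D min by simp
next
  assume C: "C \<in> Z \<and> C \<noteq> {} \<and> (\<forall>D\<in>Z. D \<subset> C \<longrightarrow> D = {})"
  then have "C \<subseteq> ground M" using Z by blast
  moreover have "\<not> indep M C" using C ind[OF \<open>C \<subseteq> ground M\<close>] by blast
  moreover have "indep M D" if "D \<subset> C" for D
    using C ind[of D] that \<open>C \<subseteq> ground M\<close> by blast
  ultimately show "circuit M C" by (simp add: circuit_def)
qed


section \<open>Cycles and even edge sets\<close>

text \<open>The kernel of the vertex-edge incidence matrix over GF(2), that is, the edge sets with
  even degree at every vertex. A loop would contribute 1 instead of 2, so loopless graphs are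
  assumed where this is used.\<close>

definition even_sets :: "('v, 'e) pre_graph \<Rightarrow> 'e set set" where
  "even_sets G = cycle_space (edges G) (\<lambda>v x. of_bool (v \<in> ends G x))"

lemma sum_cyclic_shift: "(\<Sum>i<n. g (Suc i mod n)) = (\<Sum>i<n. g i)"
  for g :: "nat \<Rightarrow> 'a::comm_monoid_add"
proof (cases n)
  case (Suc k)
  have "(\<Sum>i<Suc k. g (Suc i mod Suc k)) = (\<Sum>i<k. g (Suc i)) + g 0"
    by simp
  also have "\<dots> = (\<Sum>i<Suc k. g i)" by (simp only: sum.lessThan_Suc_shift add.commute)
  finally show ?thesis by (simp only: Suc)
qed simp

text \<open>Going round the cycle, each vertex is met once as the first and once as the second end
  of an edge, and the two contributions cancel.\<close>

lemma cycle_in_even_sets: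
  assumes loopless: "\<And>x. x \<in> edges G \<Longrightarrow> card (ends G x) = 2" and "cycle G C"
  shows "C \<in> even_sets G" "C \<noteq> {}"
proof -
  obtain vs es where es: "es \<noteq> []" and len: "length vs = length es"
    and dist: "distinct vs" "distinct es" and sub: "set es \<subseteq> edges G" and C: "set es = C"
    and ends: "\<forall>i<length es. ends G (es ! i) = {vs ! i, vs ! (Suc i mod length vs)}"
    using assms(2) unfolding cycle_def by blast
  define n where "n = length es"
  \<comment> \<open>The two ends of a non-loop differ, so the indicator of the pair is the sum of
    the two indicators.\<close>
  have split: "(of_bool (v \<in> ends G (es ! i)) :: bit) =
      of_bool (v = vs ! i) + of_bool (v = vs ! (Suc i mod n))" if "i < n" for v i
  proof -
    have "card (ends G (es ! i)) = 2" using that sub by (intro loopless) (auto simp: n_def)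
    then have "vs ! i \<noteq> vs ! (Suc i mod n)"
      using ends that len by (auto simp: n_def card_insert_if split: if_splits)
    then show ?thesis using ends that len by (auto simp: n_def)
  qed
  have "(\<Sum>x\<in>C. of_bool (v \<in> ends G x)) = (0 :: bit)" for v
  proof -
    have "(\<Sum>x\<in>C. of_bool (v \<in> ends G x)) = (\<Sum>i<n. (of_bool (v \<in> ends G (es ! i)) :: bit))"
      unfolding C[symmetric] n_def
      using bij_betw_nth[OF dist(2) refl refl] by (rule sum.reindex_bij_betw[symmetric])
    also have "\<dots> = (\<Sum>i<n. of_bool (v = vs ! i) + of_bool (v = vs ! (Suc i mod n)))"
      using split by (intro sum.cong) auto
    also have "\<dots> = (\<Sum>i<n. of_bool (v = vs ! i)) + (\<Sum>i<n. of_bool (v = vs ! i))"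
      using sum_cyclic_shift[of "\<lambda>i. of_bool (v = vs ! i) :: bit" n] by (simp only: sum.distrib)
    finally show ?thesis by simp
  qed
  then show "C \<in> even_sets G" using sub C by (auto simp only: even_sets_def cycle_space_def)
  show "C \<noteq> {}" using es C by auto
qed

definition path_in :: "('v, 'e) pre_graph \<Rightarrow> 'e set \<Rightarrow> 'v list \<Rightarrow> 'e list \<Rightarrow> bool" where
  "path_in G D vs es \<longleftrightarrow> length vs = Suc (length es) \<and> distinct vs \<and> distinct es \<and>
    set vs \<subseteq> verts G \<and> set es \<subseteq> D \<and> (\<forall>i<length es. ends G (es ! i) = {vs ! i, vs ! Suc i})"

text \<open>Consider a longest path with edges in \<open>D\<close>. Its first vertex has even degree
  in \<open>D\<close>, so it meets a second edge \<open>y\<close> of \<open>D\<close>; by maximality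
  the other end of \<open>y\<close> is on the path, and \<open>y\<close> closes a cycle.\<close>

lemma even_set_contains_cycle:
  assumes G: "graph G" and loopless: "\<And>x. x \<in> edges G \<Longrightarrow> card (ends G x) = 2"
    and D: "D \<in> even_sets G" "D \<noteq> {}"
  shows "\<exists>C\<subseteq>D. cycle G C"
proof -
  interpret graph G by fact
  have DE: "D \<subseteq> edges G" and even: "(\<Sum>x\<in>D. of_bool (v \<in> ends G x)) = (0 :: bit)" for v
    using D(1) by (auto simp only: even_sets_def cycle_space_def)
  have finD: "finite D" using DE finite_edges by (rule finite_subset)
  obtain x where x: "x \<in> D" using D(2) by blast
  obtain u v where uv: "ends G x = {u, v}" "u \<noteq> v"
    using loopless[of x] x DE by (auto simp: card_2_iff)
  \<comment> \<open>A path with one edge; by comparison with it, the longest path has a first edge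
    \<open>es ! 0\<close>.\<close>
  have path_uv: "path_in G D [u, v] [x]"
    using uv x ends_subset[of x] DE by (auto simp: path_in_def)
  then have start: "\<exists>vs es. path_in G D vs es \<and> length es = 1" by fastforce
  \<comment> \<open>Path vertices are distinct, so lengths are bounded and a longest path
    exists.\<close>
  have bound: "length es \<le> card (verts G)" if "path_in G D vs es" for vs es
  proof -
    have "length vs = card (set vs)" using that by (simp add: path_in_def distinct_card)
    also have "\<dots> \<le> card (verts G)"
      using that finite_verts by (auto simp: path_in_def intro: card_mono)
    finally show ?thesis using that by (simp add: path_in_def)
  qed
  then have "\<forall>k. (\<exists>vs es. path_in G D vs es \<and> length es = k) \<longrightarrow> k \<le> card (verts G)" by blast
  from Nat.ex_has_greatest_nat[of "\<lambda>k. \<exists>vs es. path_in G D vs es \<and> length es = k", OF start this]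
  obtain k where "\<exists>vs es. path_in G D vs es \<and> length es = k"
    and max_k: "\<And>j. \<exists>vs es. path_in G D vs es \<and> length es = j \<Longrightarrow> j \<le> k"
    by blast
  then obtain vs es where p: "path_in G D vs es" and k: "length es = k" by blast
  have max: "length es' \<le> length es" if "path_in G D vs' es'" for vs' es'
    unfolding k using that by (intro max_k) blast
  have len: "length vs = Suc (length es)" and dist: "distinct vs" "distinct es"
    and sub: "set vs \<subseteq> verts G" "set es \<subseteq> D"
    and ends: "\<And>i. i < length es \<Longrightarrow> ends G (es ! i) = {vs ! i, vs ! Suc i}"
    using p by (auto simp: path_in_def)
  have "0 < length es" using max[OF path_uv] by (cases es) simp_all
  then have e0: "es ! 0 \<in> D" "vs ! 0 \<in> ends G (es ! 0)" using sub ends[of 0] nth_mem[of 0 es] by auto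
  have "\<exists>y\<in>D - {es ! 0}. vs ! 0 \<in> ends G y"
  proof (rule ccontr)
    assume no: "\<not> ?thesis"
    have "(\<Sum>y\<in>D. of_bool (vs ! 0 \<in> ends G y)) =
        (of_bool (vs ! 0 \<in> ends G (es ! 0)) :: bit) + (\<Sum>y\<in>D - {es ! 0}. of_bool (vs ! 0 \<in> ends G y))"
      using finD e0(1) by (rule sum.remove)
    also have "(\<Sum>y\<in>D - {es ! 0}. of_bool (vs ! 0 \<in> ends G y)) = (0 :: bit)"
      using no by (intro sum.neutral) auto
    finally show False using even[of "vs ! 0"] e0(2) by simp
  qed
  then obtain y where y: "y \<in> D" "y \<noteq> es ! 0" "vs ! 0 \<in> ends G y" by blast
  obtain w where w: "ends G y = {vs ! 0, w}" "w \<noteq> vs ! 0"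
  proof -
    have "card (ends G y) = 2" using loopless y(1) DE by blast
    then show ?thesis using that y(3) unfolding card_2_iff by (metis doubleton_eq_iff insert_iff singletonD)
  qed
  have y_es: "y \<noteq> es ! i" if "i < length es" for i
  proof (cases i)
    case 0
    then show ?thesis using y(2) by simp
  next
    case (Suc k)
    have "vs ! 0 \<notin> ends G (es ! i)"
      using ends[OF that] that len dist(1) Suc by (auto simp: nth_eq_iff_index_eq)
    then show ?thesis using y by auto
  qed
  have "w \<in> set vs"
  proof (rule ccontr)
    assume "w \<notin> set vs"
    moreover have "w \<in> verts G" using w ends_subset[of y] y DE by auto
    moreover have "y \<notin> set es" using y_es by (auto simp: in_set_conv_nth)
    moreover have "ends G ((y # es) ! i) = {(w # vs) ! i, (w # vs) ! Suc i}"
      if "i < length (y # es)" for i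
      using that ends w by (cases i) auto
    ultimately have "path_in G D (w # vs) (y # es)"
      unfolding path_in_def using len dist sub y(1) by (simp del: nth_Cons_Suc)
    then show False using max[of "w # vs" "y # es"] by simp
  qed
  then obtain k where k: "k < length vs" "w = vs ! k" by (auto simp: in_set_conv_nth)
  \<comment> \<open>The path up to \<open>w = vs ! k\<close> has \<open>k\<close> edges and
    \<open>Suc k\<close> vertices; \<open>y\<close> is the edge that leads back to
    \<open>vs ! 0\<close>.\<close>
  have "cycle G (set (take k es @ [y]))"
    unfolding cycle_def
  proof (intro exI conjI allI impI)
    show "distinct (take k es @ [y])"
      using dist y_es by (auto simp: in_set_conv_nth)
    show "distinct (take (Suc k) vs)" using dist by simp
    show "length (take (Suc k) vs) = length (take k es @ [y])" using k len by simp
    show "set (take (Suc k) vs) \<subseteq> verts G"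
      using set_take_subset sub(1) by (rule subset_trans)
    show "set (take k es @ [y]) \<subseteq> edges G" using sub(2) DE y(1) set_take_subset[of k es] by auto
    fix i assume i: "i < length (take k es @ [y])"
    show "ends G ((take k es @ [y]) ! i) =
        {take (Suc k) vs ! i, take (Suc k) vs ! (Suc i mod length (take (Suc k) vs))}"
    proof (cases "i < k")
      case True
      then show ?thesis using k len ends by (simp add: nth_append)
    next
      case False
      then have "i = k" using i by simp
      then show ?thesis using k len w by (auto simp: nth_append)
    qed
  qed simp_all
  moreover have "set (take k es @ [y]) \<subseteq> D" using sub(2) y(1) set_take_subset[of k es] by auto
  ultimately show ?thesis by blast
qed

text \<open>Brings the cycle matroid into the same form as the binary description of
  \<open>M\<close>, so that an isomorphism only has to match two families of sets. Cycles are
  nonempty even sets, and nonempty even sets contain cycles.\<close>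

lemma indep_cycle_matroid_iff:
  assumes "graph G" and "\<And>x. x \<in> edges G \<Longrightarrow> card (ends G x) = 2" and "X \<subseteq> edges G"
  shows "indep (cycle_matroid G) X \<longleftrightarrow> (\<forall>D\<in>even_sets G. D \<subseteq> X \<longrightarrow> D = {})"
proof
  assume "indep (cycle_matroid G) X"
  then have no: "\<not> (\<exists>C\<subseteq>X. cycle G C)" by (simp add: cycle_matroid_def)
  show "\<forall>D\<in>even_sets G. D \<subseteq> X \<longrightarrow> D = {}"
  proof (intro ballI impI)
    fix D assume D: "D \<in> even_sets G" "D \<subseteq> X"
    show "D = {}"
      using even_set_contains_cycle[OF assms(1,2) D(1)] D(2) no by (meson subset_trans)
  qed
next
  assume no: "\<forall>D\<in>even_sets G. D \<subseteq> X \<longrightarrow> D = {}"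
  have "\<not> cycle G C" if "C \<subseteq> X" for C
    using cycle_in_even_sets[OF assms(2), of C] that no by blast
  then show "indep (cycle_matroid G) X" using assms(3) by (simp add: cycle_matroid_def)
qed


section \<open>Clean ladders\<close>

lemma graph_iso_refl: "graph_iso G G"
  unfolding graph_iso_def by (intro exI[of _ "\<lambda>v. v"] exI[of _ "\<lambda>x. x"]) (simp add: bij_betw_def)

lemma graph_iso_card_verts: "graph_iso G H \<Longrightarrow> card (verts G) = card (verts H)"
  unfolding graph_iso_def by (elim exE conjE) (rule bij_betw_same_card)

text \<open>Any bijection of the vertices onto \<open>{..<n}\<close> will do, since it induces a
  bijection of the two-element subsets.\<close>

lemma graph_iso_complete_graph:
  assumes "finite (verts G)" "card (verts G) = n"
    and ends: "bij_betw (ends G) (edges G) {s. s \<subseteq> verts G \<and> card s = 2}"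
  shows "graph_iso G (complete_graph n)"
proof -
  obtain \<phi> where \<phi>: "bij_betw \<phi> (verts G) {..<n}"
    using assms(1,2) ex_bij_betw_finite_nat[of "verts G"] by (auto simp: lessThan_atLeast0)
  have "bij_betw ((`) \<phi>) {s. s \<subseteq> verts G \<and> card s = 2} {s. s \<subseteq> {..<n} \<and> card s = 2}"
  proof -
    have pow: "bij_betw ((`) \<phi>) (Pow (verts G)) (Pow {..<n})" using \<phi> by (rule bij_betw_Pow)
    have c: "card (\<phi> ` s) = card s" if "s \<subseteq> verts G" for s
      using \<phi> that by (meson bij_betw_imp_inj_on card_image inj_on_subset)
    have "(`) \<phi> ` {s. s \<subseteq> verts G \<and> card s = 2} = {s. s \<subseteq> {..<n} \<and> card s = 2}"
    proof (rule equalityI; rule subsetI)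
      fix s assume "s \<in> (`) \<phi> ` {s. s \<subseteq> verts G \<and> card s = 2}"
      then show "s \<in> {s. s \<subseteq> {..<n} \<and> card s = 2}" using c pow by (auto simp: bij_betw_def)
    next
      fix s assume s: "s \<in> {s. s \<subseteq> {..<n} \<and> card s = 2}"
      then have "s \<in> (`) \<phi> ` Pow (verts G)" using pow by (simp add: bij_betw_def)
      then obtain t where "t \<subseteq> verts G" "s = \<phi> ` t" by blast
      then show "s \<in> (`) \<phi> ` {s. s \<subseteq> verts G \<and> card s = 2}" using s c by auto
    qed
    then show ?thesis using pow by (auto simp: bij_betw_def intro: inj_on_subset)
  qed
  then have "bij_betw ((`) \<phi> \<circ> ends G) (edges G) (edges (complete_graph n))"
    using bij_betw_trans[OF ends] by (simp add: complete_graph_def)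
  moreover have "bij_betw \<phi> (verts G) (verts (complete_graph n))"
    using \<phi> by (simp add: complete_graph_def)
  ultimately show ?thesis
    unfolding graph_iso_def by (intro exI[of _ \<phi>] exI[of _ "(`) \<phi> \<circ> ends G"])
      (simp add: complete_graph_def)
qed

text \<open>
  The edge labels \<open>5 k\<close>, \<open>5 k + 1\<close>, \<open>5 k + 2\<close> are parallel rungs, so that a \<open>B\<^sub>3\<close> can be inserted
  at each rung: \<open>5 k + 1\<close> survives in the ladder, the other two serve as basepoints, except that
  the last label \<open>5 m\<close> is the end rung \<open>f\<close>. All graphs below share the one end function, and all 2-sums are formed with the identity renaming.
\<close>

definition ladder_ends :: "nat \<Rightarrow> nat set" where
  "ladder_ends x = (let k = x div 5 in
    {k, if x mod 5 = 3 then k + 2 else if x mod 5 = 4 then k + 3 else k + 1})"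

lemma ladder_ends_add:
  "r < 5 \<Longrightarrow> ladder_ends (5 * k + r) = {k, if r = 3 then k + 2 else if r = 4 then k + 3 else k + 1}"
  by (simp add: ladder_ends_def)

lemma ladder_ends_simps [simp]:
  "ladder_ends (5 * k) = {k, Suc k}" "ladder_ends (Suc (5 * k)) = {k, Suc k}"
  "ladder_ends (Suc (Suc (5 * k))) = {k, Suc k}" "ladder_ends (5 * k + 3) = {k, k + 2}"
  "ladder_ends (5 * k + 4) = {k, k + 3}" "ladder_ends (5 * k + 5) = {Suc k, k + 2}"
  "ladder_ends (5 * k + 6) = {Suc k, k + 2}" "ladder_ends (5 * k + 8) = {Suc k, k + 3}"
  "ladder_ends (5 * k + 10) = {k + 2, k + 3}"
  using ladder_ends_add[of 0 k] ladder_ends_add[of 1 k] ladder_ends_add[of 2 k]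
    ladder_ends_add[of 3 k] ladder_ends_add[of 4 k] ladder_ends_add[of 0 "k + 1"]
    ladder_ends_add[of 1 "k + 1"] ladder_ends_add[of 3 "k + 1"] ladder_ends_add[of 0 "k + 2"]
  by (simp_all add: add.commute numeral_3_eq_3)

definition ladder_graph :: "nat set \<Rightarrow> nat set \<Rightarrow> (nat, nat) pre_graph" where
  "ladder_graph V X = \<lparr>verts = V, edges = X, ends = ladder_ends\<rparr>"

lemma ladder_graph_simps [simp]:
  "verts (ladder_graph V X) = V" "edges (ladder_graph V X) = X"
  "ends (ladder_graph V X) = ladder_ends"
  by (simp_all add: ladder_graph_def)

lemma card_ladder_ends: "card (ladder_ends x) = 2"
  by (simp add: ladder_ends_def Let_def)

lemma graph_ladder_graph:
  assumes "finite V" "finite X" "\<And>x. x \<in> X \<Longrightarrow> ladder_ends x \<subseteq> V"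
  shows "graph (ladder_graph V X)"
  using assms by unfold_locales (simp_all add: card_ladder_ends)

lemma two_sum_ladder_graph:
  assumes "X \<inter> Y = {q}" "V \<inter> W = ladder_ends q"
  shows "two_sum q (ladder_graph V X) (ladder_graph W Y) (ladder_graph (V \<union> W) (X \<union> Y - {q}))"
  unfolding two_sum_def ladder_graph_simps using assms
  by (intro conjI exI[of _ "\<lambda>v. v"]) (auto simp: ladder_graph_def fun_eq_iff)

section \<open>The blocks K_3, K_4 and B_3 inside the ladder\<close>

lemma card_2_subsets_triangle:
  assumes "distinct [a, b, c]"
  shows "{s. s \<subseteq> {a, b, c} \<and> card s = 2} = {{a, b}, {a, c}, {b, c}}"
  using assms by (auto simp: card_2_iff doubleton_eq_iff)

lemma card_2_subsets_quad:
  assumes "distinct [a, b, c, d]"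
  shows "{s. s \<subseteq> {a, b, c, d} \<and> card s = 2} =
    {{a, b}, {a, c}, {a, d}, {b, c}, {b, d}, {c, d}}"
proof (rule equalityI; rule subsetI)
  fix s assume s: "s \<in> {s. s \<subseteq> {a, b, c, d} \<and> card s = 2}"
  then have "card s = 2" by simp
  then obtain x y where xy: "s = {x, y}" "x \<noteq> y" unfolding card_2_iff by (elim exE conjE)
  then have "x \<in> {a, b, c, d}" "y \<in> {a, b, c, d}" using s by simp_all
  then show "s \<in> {{a, b}, {a, c}, {a, d}, {b, c}, {b, d}, {c, d}}"
    using xy by (elim insertE emptyE) (simp_all add: insert_commute)
next
  fix s assume "s \<in> {{a, b}, {a, c}, {a, d}, {b, c}, {b, d}, {c, d}}"
  then show "s \<in> {s. s \<subseteq> {a, b, c, d} \<and> card s = 2}"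
    using assms by (elim insertE emptyE) simp_all
qed

text \<open>The triangle has entry rung \<open>b\<close> and exit rung \<open>5 * k + 5\<close>. The
  entry rung is \<open>5 * k\<close> or \<open>5 * k + 2\<close> when it is a basepoint, and
  \<open>5 * k + 1\<close> for the first block, where it is the edge \<open>1\<close> that stands
  for \<open>e\<close>.\<close>

lemma triangle_iso:
  assumes "b \<in> {5 * k, 5 * k + 1, 5 * k + 2}"
  shows "graph_iso (ladder_graph {k, k + 1, k + 2} {b, 5 * k + 3, 5 * k + 5}) (complete_graph 3)"
proof (rule graph_iso_complete_graph)
  have b: "ladder_ends b = {k, k + 1}" "b \<noteq> 5 * k + 3" "b \<noteq> 5 * k + 5"
    using assms ladder_ends_simps(1-3) by auto
  show "bij_betw (ends (ladder_graph {k, k + 1, k + 2} {b, 5 * k + 3, 5 * k + 5}))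
    (edges (ladder_graph {k, k + 1, k + 2} {b, 5 * k + 3, 5 * k + 5}))
    {s. s \<subseteq> verts (ladder_graph {k, k + 1, k + 2} {b, 5 * k + 3, 5 * k + 5}) \<and> card s = 2}"
    unfolding ladder_graph_simps bij_betw_def
    by (subst card_2_subsets_triangle) (auto simp: b inj_on_def doubleton_eq_iff)
qed simp_all

text \<open>Entry rung \<open>b\<close> on \<open>k, k + 1\<close> and exit rung
  \<open>5 * k + 10\<close> on \<open>k + 2, k + 3\<close> form a matching. The rails are
  \<open>5 * k + 3\<close> and \<open>5 * k + 8\<close>; \<open>5 * k + 4\<close> and the rung
  \<open>5 * k + 6\<close> are the crossing chords.\<close>

lemma quad_iso:
  assumes "b \<in> {5 * k, 5 * k + 1, 5 * k + 2}"
  shows "graph_iso (ladder_graph {k, k + 1, k + 2, k + 3}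
      {b, 5 * k + 3, 5 * k + 4, 5 * k + 6, 5 * k + 8, 5 * k + 10}) (complete_graph 4)"
    (is "graph_iso ?G _")
proof (rule graph_iso_complete_graph)
  have b: "ladder_ends b = {k, k + 1}" "b < 5 * k + 3"
    using assms ladder_ends_simps(1-3) by auto
  show "bij_betw (ends ?G) (edges ?G) {s. s \<subseteq> verts ?G \<and> card s = 2}"
    unfolding ladder_graph_simps bij_betw_def
    using b(2) by (subst card_2_subsets_quad) (auto simp: b(1) inj_on_def doubleton_eq_iff)
qed simp_all

lemma B3_iso: "graph_iso (ladder_graph {k, k + 1} {5 * k, 5 * k + 1, 5 * k + 2}) B3"
  unfolding graph_iso_def
proof (intro exI conjI)
  show "bij_betw (\<lambda>v. v - k) (verts (ladder_graph {k, k + 1} {5 * k, 5 * k + 1, 5 * k + 2})) (verts B3)"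
    by (auto simp: bij_betw_def B3_def)
  show "bij_betw (\<lambda>x. x - 5 * k) (edges (ladder_graph {k, k + 1} {5 * k, 5 * k + 1, 5 * k + 2})) (edges B3)"
    by (auto simp: bij_betw_def B3_def)
  show "\<forall>x\<in>edges (ladder_graph {k, k + 1} {5 * k, 5 * k + 1, 5 * k + 2}). ends B3 (x - 5 * k) =
      (\<lambda>v. v - k) ` ends (ladder_graph {k, k + 1} {5 * k, 5 * k + 1, 5 * k + 2}) x"
    using ladder_ends_simps(1-3)[of k] by (auto simp: B3_def)
qed

lemma not_B3_if_card: "card (verts G) \<noteq> 2 \<Longrightarrow> \<not> graph_iso G B3"
  using graph_iso_card_verts[of G B3] by (auto simp: B3_def)

lemma not_K4_if_card: "card (verts G) \<noteq> 4 \<Longrightarrow> \<not> graph_iso G (complete_graph 4)"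
  using graph_iso_card_verts[of G "complete_graph 4"] by (auto simp: complete_graph_def)

section \<open>Path decompositions built one block at a time\<close>

definition building_block :: "('v, 'e) pre_graph \<Rightarrow> bool" where
  "building_block G \<longleftrightarrow> graph G \<and>
    (graph_iso G (complete_graph 4) \<or> graph_iso G (complete_graph 3) \<or> graph_iso G B3)"

text \<open>The conditions of \<open>clean_ladder\<close> without those on the last graph and on
  \<open>L\<close>. A chain may therefore end in \<open>B3\<close> temporarily, which makes
  induction along the path possible.\<close>

definition ladder_chain :: "nat \<Rightarrow> (nat \<Rightarrow> (nat, nat) pre_graph) \<Rightarrow> (nat \<Rightarrow> nat) \<Rightarrow>
    (nat \<Rightarrow> (nat, nat) pre_graph) \<Rightarrow> bool" where
  "ladder_chain n G p H \<longleftrightarrow>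
    (\<forall>i\<le>n. building_block (G i)) \<and>
    (\<forall>i\<in>{1..n}. edges (G (i - 1)) \<inter> edges (G i) = {p i}) \<and>
    (\<forall>i j. i + 1 < j \<and> j \<le> n \<longrightarrow> edges (G i) \<inter> edges (G j) = {}) \<and>
    (\<forall>i. 0 < i \<and> i < n \<longrightarrow> p i \<noteq> p (i + 1)) \<and>
    \<not> graph_iso (G 0) B3 \<and>
    (\<forall>i\<in>{1..n}. \<not> (graph_iso (G (i - 1)) B3 \<and> graph_iso (G i) B3)) \<and>
    (\<forall>i. 0 < i \<and> i < n \<and> graph_iso (G i) (complete_graph 4) \<longrightarrow>
      ends (G i) (p i) \<inter> ends (G i) (p (i + 1)) = {}) \<and>
    H 0 = G 0 \<and>
    (\<forall>i\<in>{1..n}. two_sum (p i) (H (i - 1)) (G i) (H i))"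

lemma clean_ladderI:
  assumes "graph L" "ladder_chain n G p H" "\<not> graph_iso (G n) B3" "graph_iso L (H n)"
  shows "clean_ladder L"
  unfolding clean_ladder_def
  using assms(1,3,4) assms(2)[unfolded ladder_chain_def building_block_def]
  by (elim conjE)
    (intro conjI exI[of _ n] exI[of _ G] exI[of _ p] exI[of _ H]; assumption)

text \<open>The hypotheses are the instances of the chain conditions that are new at
  \<open>Suc n\<close>. Those on \<open>p n\<close> and on K_4 concern the old last graph, which
  only now becomes an inner vertex of the path and has both its basepoints.\<close>

lemma ladder_chain_extend:
  assumes chain: "ladder_chain n G p H"
    and G': "building_block G'"
    and q: "edges (G n) \<inter> edges G' = {q}" "\<And>i. i < n \<Longrightarrow> edges (G i) \<inter> edges G' = {}"
    and pq: "0 < n \<Longrightarrow> p n \<noteq> q"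
    and B3: "\<not> (graph_iso (G n) B3 \<and> graph_iso G' B3)"
    and K4: "0 < n \<Longrightarrow> graph_iso (G n) (complete_graph 4) \<Longrightarrow> ends (G n) (p n) \<inter> ends (G n) q = {}"
    and H': "two_sum q (H n) G' H'"
  shows "ladder_chain (Suc n) (G(Suc n := G')) (p(Suc n := q)) (H(Suc n := H'))"
proof -
  have le: "i \<le> Suc n \<longleftrightarrow> i \<le> n \<or> i = Suc n" for i by auto
  have lt: "i < Suc n \<longleftrightarrow> i < n \<or> i = n" for i by auto
  have mem: "i \<in> {1..Suc n} \<longleftrightarrow> i \<in> {1..n} \<or> i = Suc n" for i by auto
  note c = chain[unfolded ladder_chain_def]
  show ?thesis
    unfolding ladder_chain_def
  proof (intro conjI)
    show "\<forall>i\<le>Suc n. building_block ((G(Suc n := G')) i)"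
      using c G' by (simp add: le)
    show "\<forall>i\<in>{1..Suc n}. edges ((G(Suc n := G')) (i - 1)) \<inter> edges ((G(Suc n := G')) i) =
        {(p(Suc n := q)) i}"
      using c q(1) by (auto simp: mem)
    show "\<forall>i j. i + 1 < j \<and> j \<le> Suc n \<longrightarrow>
        edges ((G(Suc n := G')) i) \<inter> edges ((G(Suc n := G')) j) = {}"
      using c q(2) by (auto simp: le)
    show "\<forall>i. 0 < i \<and> i < Suc n \<longrightarrow> (p(Suc n := q)) i \<noteq> (p(Suc n := q)) (i + 1)"
      using c pq by (auto simp: lt)
    show "\<not> graph_iso ((G(Suc n := G')) 0) B3" using c by simp
    show "\<forall>i\<in>{1..Suc n}. \<not> (graph_iso ((G(Suc n := G')) (i - 1)) B3 \<and>
        graph_iso ((G(Suc n := G')) i) B3)"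
      using c B3 by (auto simp: mem)
    show "\<forall>i. 0 < i \<and> i < Suc n \<and> graph_iso ((G(Suc n := G')) i) (complete_graph 4) \<longrightarrow>
        ends ((G(Suc n := G')) i) ((p(Suc n := q)) i) \<inter>
        ends ((G(Suc n := G')) i) ((p(Suc n := q)) (i + 1)) = {}"
      using c K4 by (simp add: lt)
    show "(H(Suc n := H')) 0 = (G(Suc n := G')) 0" using c by simp
    show "\<forall>i\<in>{1..Suc n}. two_sum ((p(Suc n := q)) i) ((H(Suc n := H')) (i - 1))
        ((G(Suc n := G')) i) ((H(Suc n := H')) i)"
      using c H' by (auto simp: mem)
  qed
qed

text \<open>
  A partial ladder whose last basepoint \<open>q\<close> is still present and carries the largest label in use;
  if \<open>c\<close> holds, the last graph on the path is not \<open>B\<^sub>3\<close>.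
\<close>

definition ladder_stage :: "bool \<Rightarrow> nat \<Rightarrow> nat \<Rightarrow> nat set \<Rightarrow> bool" where
  "ladder_stage c k q X \<longleftrightarrow> (\<exists>n G p H. ladder_chain n G p H \<and> H n = ladder_graph {..k + 1} X \<and>
    q \<in> X \<and> X \<subseteq> {..q} \<and> q \<in> edges (G n) \<and> (\<forall>i\<le>n. edges (G i) \<subseteq> {..q}) \<and>
    (\<forall>i<n. q \<notin> edges (G i)) \<and> ends (G n) = ladder_ends \<and> (0 < n \<longrightarrow> p n \<noteq> q) \<and>
    (0 < n \<and> graph_iso (G n) (complete_graph 4) \<longrightarrow> ladder_ends (p n) \<inter> ladder_ends q = {}) \<and>
    (c \<longrightarrow> \<not> graph_iso (G n) B3))"

lemma ladder_stage_base:
  assumes "building_block (ladder_graph {..k + 1} X)" "\<not> graph_iso (ladder_graph {..k + 1} X) B3"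
    and "q \<in> X" "X \<subseteq> {..q}"
  shows "ladder_stage True k q X"
  unfolding ladder_stage_def
  using assms
  by (intro exI[of _ 0] exI[of _ "\<lambda>_. ladder_graph {..k + 1} X"] exI[of _ "\<lambda>_. q"])
    (simp add: ladder_chain_def)

text \<open>All labels in use are at most \<open>q\<close> and only the last graph contains
  \<open>q\<close>. So \<open>Y \<inter> {..q} = {q}\<close> makes the new block meet the last graph
  in \<open>q\<close> alone and all earlier ones not at all. The flags \<open>c\<close> and
  \<open>c'\<close> keep two copies of \<open>B3\<close> from being adjacent.\<close>

lemma ladder_stage_step:
  assumes stage: "ladder_stage c k q X"
    and block: "building_block (ladder_graph W Y)"
    and Y: "Y \<inter> {..q} = {q}" and W: "{..k + 1} \<inter> W = ladder_ends q" "{..k + 1} \<union> W = {..k' + 1}"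
    and q': "q' \<in> Y" "Y \<subseteq> {..q'}" "q < q'"
    and B3: "\<not> c \<Longrightarrow> \<not> graph_iso (ladder_graph W Y) B3"
      "c' \<Longrightarrow> \<not> graph_iso (ladder_graph W Y) B3"
    and K4: "graph_iso (ladder_graph W Y) (complete_graph 4) \<Longrightarrow> ladder_ends q \<inter> ladder_ends q' = {}"
  shows "ladder_stage c' k' q' (X \<union> Y - {q})"
proof -
  obtain n G p H where chain: "ladder_chain n G p H" and H: "H n = ladder_graph {..k + 1} X"
    and X: "q \<in> X" "X \<subseteq> {..q}" and q1: "q \<in> edges (G n)"
    and q2: "\<forall>i\<le>n. edges (G i) \<subseteq> {..q}" and q3: "\<forall>i<n. q \<notin> edges (G i)"
    and ends: "ends (G n) = ladder_ends" and pq: "0 < n \<longrightarrow> p n \<noteq> q"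
    and pK4: "0 < n \<and> graph_iso (G n) (complete_graph 4) \<longrightarrow> ladder_ends (p n) \<inter> ladder_ends q = {}"
    and nB3: "c \<longrightarrow> \<not> graph_iso (G n) B3"
    using stage unfolding ladder_stage_def by (elim exE conjE)
  have q: "edges (G i) \<subseteq> {..q}" if "i \<le> n" for i using q2 that by blast
  define H' where "H' = ladder_graph {..k' + 1} (X \<union> Y - {q})"
  have "X \<inter> Y = {q}" using X Y by blast
  then have sum: "two_sum q (H n) (ladder_graph W Y) H'"
    using two_sum_ladder_graph[of X Y q "{..k + 1}" W] W H by (simp add: H'_def)
  have "ladder_chain (Suc n) (G(Suc n := ladder_graph W Y)) (p(Suc n := q)) (H(Suc n := H'))"
  proof (rule ladder_chain_extend[OF chain block])
    show "edges (G n) \<inter> edges (ladder_graph W Y) = {q}" using q1 q[of n] Y by auto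
    show "edges (G i) \<inter> edges (ladder_graph W Y) = {}" if "i < n" for i
    proof -
      have "edges (G i) \<subseteq> {..q}" "q \<notin> edges (G i)" using q[of i] q3 that by simp_all
      then show ?thesis using Y by auto
    qed
    show "p n \<noteq> q" if "0 < n" using pq that by simp
    show "\<not> (graph_iso (G n) B3 \<and> graph_iso (ladder_graph W Y) B3)" using B3(1) nB3 by blast
    show "ends (G n) (p n) \<inter> ends (G n) q = {}"
      if "0 < n" "graph_iso (G n) (complete_graph 4)" using pK4 that ends by simp
    show "two_sum q (H n) (ladder_graph W Y) H'" by (rule sum)
  qed
  moreover have "edges ((G(Suc n := ladder_graph W Y)) i) \<subseteq> {..q'}" if "i \<le> Suc n" for i
    using q[of i] q'(2,3) that by (cases "i = Suc n") auto
  moreover have "q' \<notin> edges ((G(Suc n := ladder_graph W Y)) i)" if "i < Suc n" for i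
    using q[of i] q'(3) that by auto
  moreover have "q' \<in> X \<union> Y - {q}" "X \<union> Y - {q} \<subseteq> {..q'}" using q' X(2) by auto
  ultimately show ?thesis
    unfolding ladder_stage_def
    by (intro exI[of _ "Suc n"] exI[of _ "G(Suc n := ladder_graph W Y)"] exI[of _ "p(Suc n := q)"]
        exI[of _ "H(Suc n := H')"] conjI)
      (use q'(1,3) B3(2) K4 in \<open>simp_all add: H'_def\<close>)
qed

lemma building_blockI:
  assumes "graph_iso (ladder_graph V X) (complete_graph 4) \<or>
      graph_iso (ladder_graph V X) (complete_graph 3) \<or> graph_iso (ladder_graph V X) B3"
    and "finite V" "finite X" "\<And>x. x \<in> X \<Longrightarrow> ladder_ends x \<subseteq> V"
  shows "building_block (ladder_graph V X)"
  unfolding building_block_def using assms(1) graph_ladder_graph[OF assms(2-)] by blast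

text \<open>\<open>Z\<close> holds the levels of the inner rungs and \<open>W\<close> the positions
  of the edges \<open>{i, i + 3}\<close>; \<open>1\<close> is the edge \<open>e\<close>. The bound
  \<open>Suc i < k\<close> says that \<open>i + 3\<close> is a vertex of \<open>{..k + 1}\<close>.
  Rungs at level \<open>k\<close> itself are left out, as they belong to the next
  attachment.\<close>

definition ladder_edges :: "nat set \<Rightarrow> nat set \<Rightarrow> nat \<Rightarrow> nat set" where
  "ladder_edges Z W k = {1} \<union> (\<lambda>i. 5 * i + 3) ` {..<k} \<union>
    (\<lambda>j. 5 * j + 1) ` {j \<in> Z. j < k} \<union> (\<lambda>i. 5 * i + 4) ` {i \<in> W. Suc i < k}"

lemma triangle_block:
  assumes "b \<in> {5 * k, 5 * k + 1, 5 * k + 2}"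
  shows "building_block (ladder_graph {k, k + 1, k + 2} {b, 5 * k + 3, 5 * k + 5})"
proof (rule building_blockI)
  have "ladder_ends b = {k, k + 1}" using assms by auto
  then show "ladder_ends x \<subseteq> {k, k + 1, k + 2}" if "x \<in> {b, 5 * k + 3, 5 * k + 5}" for x
    using that by (elim insertE emptyE) simp_all
qed (use triangle_iso[OF assms] in simp_all)

lemma quad_block:
  assumes "b \<in> {5 * k, 5 * k + 1, 5 * k + 2}"
  shows "building_block (ladder_graph {k, k + 1, k + 2, k + 3}
    {b, 5 * k + 3, 5 * k + 4, 5 * k + 6, 5 * k + 8, 5 * k + 10})"
proof (rule building_blockI)
  have "ladder_ends b = {k, k + 1}" using assms by auto
  then show "ladder_ends x \<subseteq> {k, k + 1, k + 2, k + 3}"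
    if "x \<in> {b, 5 * k + 3, 5 * k + 4, 5 * k + 6, 5 * k + 8, 5 * k + 10}" for x
    using that by (elim insertE emptyE) simp_all
qed (use quad_iso[OF assms] in simp_all)

lemma B3_block: "building_block (ladder_graph {k, k + 1} {5 * k, 5 * k + 1, 5 * k + 2})"
  using B3_iso by (intro building_blockI) auto

text \<open>The entry rung is \<open>5 * k\<close> if the triangle is attached directly, and
  \<open>5 * k + 2\<close> if a \<open>B3\<close> precedes it.\<close>

lemma ladder_stage_triangle:
  assumes "ladder_stage c k b X" "b \<in> {5 * k, 5 * k + 2}"
  shows "ladder_stage True (k + 1) (5 * (k + 1)) (X \<union> {b, 5 * k + 3, 5 * k + 5} - {b})"
proof (rule ladder_stage_step[OF assms(1)])
  show "building_block (ladder_graph {k, k + 1, k + 2} {b, 5 * k + 3, 5 * k + 5})"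
    using assms(2) by (intro triangle_block) auto
  show "{b, 5 * k + 3, 5 * k + 5} \<inter> {..b} = {b}" using assms(2) by auto
  have e: "ladder_ends b = {k, k + 1}" using assms(2) by auto
  then show "{..k + 1} \<inter> {k, k + 1, k + 2} = ladder_ends b" by auto
  show "{..k + 1} \<union> {k, k + 1, k + 2} = {..k + 1 + 1}" by auto
  show "{b, 5 * k + 3, 5 * k + 5} \<subseteq> {..5 * (k + 1)}" "b < 5 * (k + 1)" using assms(2) by auto
  show "\<not> graph_iso (ladder_graph {k, k + 1, k + 2} {b, 5 * k + 3, 5 * k + 5}) B3"
    "\<not> graph_iso (ladder_graph {k, k + 1, k + 2} {b, 5 * k + 3, 5 * k + 5}) B3"
    by (simp_all add: not_B3_if_card)
  show "ladder_ends b \<inter> ladder_ends (5 * (k + 1)) = {}"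
    if "graph_iso (ladder_graph {k, k + 1, k + 2} {b, 5 * k + 3, 5 * k + 5}) (complete_graph 4)"
    using that not_K4_if_card[of "ladder_graph {k, k + 1, k + 2} {b, 5 * k + 3, 5 * k + 5}"] by simp
qed simp

lemma ladder_stage_quad:
  assumes "ladder_stage c k b X" "b \<in> {5 * k, 5 * k + 2}"
  shows "ladder_stage True (k + 2) (5 * (k + 2))
    (X \<union> {b, 5 * k + 3, 5 * k + 4, 5 * k + 6, 5 * k + 8, 5 * k + 10} - {b})"
    (is "ladder_stage _ _ _ (_ \<union> ?Y - _)")
proof (rule ladder_stage_step[OF assms(1)])
  show "building_block (ladder_graph {k, k + 1, k + 2, k + 3} ?Y)"
    using assms(2) by (intro quad_block) auto
  show "?Y \<inter> {..b} = {b}" using assms(2) by auto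
  have e: "ladder_ends b = {k, k + 1}" using assms(2) by auto
  then show "{..k + 1} \<inter> {k, k + 1, k + 2, k + 3} = ladder_ends b" by auto
  show "{..k + 1} \<union> {k, k + 1, k + 2, k + 3} = {..k + 2 + 1}" by auto
  show "?Y \<subseteq> {..5 * (k + 2)}" "b < 5 * (k + 2)" using assms(2) by auto
  show "\<not> graph_iso (ladder_graph {k, k + 1, k + 2, k + 3} ?Y) B3"
    "\<not> graph_iso (ladder_graph {k, k + 1, k + 2, k + 3} ?Y) B3"
    by (simp_all add: not_B3_if_card)
  \<comment> \<open>The matching condition on the two basepoints of a K_4.\<close>
  show "ladder_ends b \<inter> ladder_ends (5 * (k + 2)) = {}"
    unfolding e ladder_ends_simps(1)[of "k + 2"] by simp
qed simp

text \<open>Inserting a \<open>B3\<close> leaves the rung \<open>5 * k + 1\<close> in the ladder and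
  moves the basepoint to the parallel edge \<open>5 * k + 2\<close>.\<close>

lemma ladder_stage_B3:
  assumes "ladder_stage True k (5 * k) X"
  shows "ladder_stage False k (5 * k + 2) (X \<union> {5 * k, 5 * k + 1, 5 * k + 2} - {5 * k})"
proof (rule ladder_stage_step[OF assms])
  show "building_block (ladder_graph {k, k + 1} {5 * k, 5 * k + 1, 5 * k + 2})" by (rule B3_block)
  show "ladder_ends (5 * k) \<inter> ladder_ends (5 * k + 2) = {}"
    if "graph_iso (ladder_graph {k, k + 1} {5 * k, 5 * k + 1, 5 * k + 2}) (complete_graph 4)"
    using that not_K4_if_card[of "ladder_graph {k, k + 1} {5 * k, 5 * k + 1, 5 * k + 2}"] by simp
qed auto

lemma ladder_edges_Suc:
  "ladder_edges Z W (Suc k) = ladder_edges Z W k \<union> {5 * k + 3} \<union> (\<lambda>j. 5 * j + 1) ` (Z \<inter> {k}) \<union>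
    (\<lambda>i. 5 * i + 4) ` {i \<in> W. Suc i = k}"
proof -
  have "{j \<in> Z. j < Suc k} = {j \<in> Z. j < k} \<union> (Z \<inter> {k})"
    "{i \<in> W. Suc i < Suc k} = {i \<in> W. Suc i < k} \<union> {i \<in> W. Suc i = k}"
    by auto
  then show ?thesis unfolding ladder_edges_def lessThan_Suc by (simp only: image_Un image_insert) blast
qed

lemma ladder_edges_0: "ladder_edges Z W 0 = {1}"
  by (simp add: ladder_edges_def)

text \<open>Surviving labels are 1, 3 or 4 modulo 5, basepoints are 0 or 2; hence deleting a
  basepoint removes no ladder edge.\<close>

lemma notin_ladder_edges: "5 * l \<notin> ladder_edges Z W k" "0 < l \<Longrightarrow> 5 * l + 2 \<notin> ladder_edges Z W k"
proof -
  have "x mod 5 \<in> {1, 3, 4}" if "x \<in> ladder_edges Z W k" for x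
    using that by (auto simp: ladder_edges_def mod_Suc)
  from this[of "5 * l"] this[of "5 * l + 2"]
  show "5 * l \<notin> ladder_edges Z W k" "5 * l + 2 \<notin> ladder_edges Z W k" by (auto simp: mod_Suc)
qed

text \<open>\<open>k - 1 \<notin> W\<close> says that no K_4 straddles level \<open>k\<close>, so
  the ladder can be cut there. The induction is strong because a K_4 advances by two levels. The
  first two hypotheses give each cross edge its partner rung and prevent two copies of K_4 from
  overlapping.\<close>

lemma ladder_stage_ladder_edges:
  assumes W: "W \<subseteq> {i. Suc i \<in> Z}" "\<And>i. i \<in> W \<Longrightarrow> Suc i \<notin> W" and Z: "0 \<notin> Z"
    and k: "0 < k" "k - 1 \<notin> W"
  shows "ladder_stage True k (5 * k) (insert (5 * k) (ladder_edges Z W k))"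
  using k
proof (induction k rule: less_induct)
  case (less k)
  \<comment> \<open>The situation before a further block is attached at level \<open>l\<close>: if
    \<open>l\<close> carries a rung, a \<open>B3\<close> is inserted first and the basepoint is
    \<open>5 * l + 2\<close>, otherwise it is \<open>5 * l\<close>.\<close>
  have entry: "\<exists>c b. b \<in> {5 * l, 5 * l + 2} \<and>
      ladder_stage c l b (insert b (ladder_edges Z W l \<union> (\<lambda>j. 5 * j + 1) ` (Z \<inter> {l})))"
    if l: "0 < l" "l < k" "l - 1 \<notin> W" for l
  proof (cases "l \<in> Z")
    case True
    have "insert (5 * l) (ladder_edges Z W l) \<union> {5 * l, 5 * l + 1, 5 * l + 2} - {5 * l} =
        insert (5 * l + 2) (ladder_edges Z W l \<union> (\<lambda>j. 5 * j + 1) ` (Z \<inter> {l}))"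
      using True notin_ladder_edges(1)[of l Z W l] by auto
    then show ?thesis using ladder_stage_B3[OF less.IH[OF l(2,1,3)]] by auto
  next
    case False
    then have "ladder_edges Z W l \<union> (\<lambda>j. 5 * j + 1) ` (Z \<inter> {l}) = ladder_edges Z W l" by auto
    then show ?thesis
      using less.IH[OF l(2,1,3)] by (intro exI[of _ True] exI[of _ "5 * l"]) simp
  qed
  \<comment> \<open>The last block is a triangle or a K_4, and it is the first block or a later
    one.\<close>
  consider "k = 1" | l where "0 < l" "k = Suc l" "l - 1 \<notin> W" | "k = 2" "0 \<in> W"
    | l where "0 < l" "k = Suc (Suc l)" "l \<in> W"
  proof (cases k)
    case (Suc l)
    then show thesis
    proof (cases l)
      case 0
      then show thesis using Suc that(1) by simp
    next
      case l: (Suc l')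
      show thesis
      proof (cases "l' \<in> W")
        case True
        then show thesis using Suc l that(3) that(4)[of l'] by (cases l') auto
      next
        case False
        then show thesis using Suc l that(2)[of l] by simp
      qed
    qed
  qed (use less.prems in simp)
  then show ?case
  proof cases
    case 1
    have X: "insert (5 * k) (ladder_edges Z W k) = {1, 5 * 0 + 3, 5 * 0 + 5}"
      using 1 Z by (auto simp: ladder_edges_Suc ladder_edges_0)
    have V: "{..k + 1} = {0, 0 + 1, 0 + 2}" using 1 by auto
    show ?thesis
    proof (rule ladder_stage_base)
      show "building_block (ladder_graph {..k + 1} (insert (5 * k) (ladder_edges Z W k)))"
        unfolding X V by (rule triangle_block) simp
      show "insert (5 * k) (ladder_edges Z W k) \<subseteq> {..5 * k}" unfolding X using 1 by simp
    qed (use 1 in \<open>simp_all add: not_B3_if_card\<close>)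
  next
    case (2 l)
    have "l \<notin> W" using less.prems 2 by simp
    obtain c b where b: "b \<in> {5 * l, 5 * l + 2}"
      "ladder_stage c l b (insert b (ladder_edges Z W l \<union> (\<lambda>j. 5 * j + 1) ` (Z \<inter> {l})))"
      using entry[of l] 2 by auto
    have none: "{i \<in> W. Suc i = l} = {}" using 2 by auto
    have "insert b (ladder_edges Z W l \<union> (\<lambda>j. 5 * j + 1) ` (Z \<inter> {l})) \<union> {b, 5 * l + 3, 5 * l + 5} - {b} =
        insert (5 * k) (ladder_edges Z W k)"
      unfolding 2(2) ladder_edges_Suc none using notin_ladder_edges[of l Z W l] b(1) 2(1) by auto
    then show ?thesis using ladder_stage_triangle[OF b(2,1)] 2(2) by simp
  next
    case 3
    have one: "1 \<in> Z" using W(1) 3 by auto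
    have k: "k = Suc (Suc 0)" using 3 by simp
    have w: "{i \<in> W. Suc i = Suc 0} = {0}" "{i \<in> W. Suc i = 0} = {}" "Z \<inter> {Suc 0} = {1}" "Z \<inter> {0} = {}"
      using 3 one Z by auto
    have X: "insert (5 * k) (ladder_edges Z W k) =
        {1, 5 * 0 + 3, 5 * 0 + 4, 5 * 0 + 6, 5 * 0 + 8, 5 * 0 + 10}"
      unfolding k ladder_edges_Suc ladder_edges_0 w by auto
    have V: "{..k + 1} = {0, 0 + 1, 0 + 2, 0 + 3}" using 3 by auto
    show ?thesis
    proof (rule ladder_stage_base)
      show "building_block (ladder_graph {..k + 1} (insert (5 * k) (ladder_edges Z W k)))"
        unfolding X V by (rule quad_block) simp
      show "insert (5 * k) (ladder_edges Z W k) \<subseteq> {..5 * k}" unfolding X using 3 by simp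
    qed (use 3 in \<open>simp_all add: not_B3_if_card\<close>)
  next
    case (4 l)
    have lZ: "Suc l \<in> Z" using W(1) 4 by blast
    have l1: "l - 1 \<notin> W" using 4(1,3) W(2)[of "l - 1"] by auto
    obtain c b where b: "b \<in> {5 * l, 5 * l + 2}"
      "ladder_stage c l b (insert b (ladder_edges Z W l \<union> (\<lambda>j. 5 * j + 1) ` (Z \<inter> {l})))"
      using entry[of l] 4 l1 by auto
    have w: "{i \<in> W. Suc i = l} = {}" "{i \<in> W. Suc i = Suc l} = {l}" "Z \<inter> {Suc l} = {Suc l}"
      using 4 l1 lZ by auto
    have "insert b (ladder_edges Z W l \<union> (\<lambda>j. 5 * j + 1) ` (Z \<inter> {l})) \<union>
        {b, 5 * l + 3, 5 * l + 4, 5 * l + 6, 5 * l + 8, 5 * l + 10} - {b} =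
        insert (5 * k) (ladder_edges Z W k)"
      unfolding 4(2) ladder_edges_Suc w using notin_ladder_edges[of l Z W l] b(1) 4(1) by auto
    then show ?thesis using ladder_stage_quad[OF b(2,1)] 4(2) by simp
  qed
qed

text \<open>At level \<open>m\<close> the pending basepoint \<open>5 * m\<close> is kept as the edge
  that stands for \<open>f\<close>. The bounds on \<open>Z\<close> keep the inner rungs from being
  parallel to the end rungs.\<close>

lemma clean_ladder_ladder_graph:
  assumes W: "W \<subseteq> {i. Suc i \<in> Z}" "\<And>i. i \<in> W \<Longrightarrow> Suc i \<notin> W"
    and Z: "0 \<notin> Z" "\<And>j. j \<in> Z \<Longrightarrow> j < m" and m: "0 < m"
  shows "clean_ladder (ladder_graph {..m + 1} (insert (5 * m) (ladder_edges Z W m)))"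
    (is "clean_ladder ?L")
proof -
  \<comment> \<open>A cross edge at \<open>m - 1\<close> would require a rung at level
    \<open>m\<close>.\<close>
  have mW: "m - 1 \<notin> W" using W(1) Z(2)[of m] m by auto
  have "finite Z" using Z(2) by (auto intro: finite_subset[of _ "{..<m}"])
  moreover have "W \<subseteq> {..<m}" using W(1) Z(2) by force
  ultimately have "graph ?L"
    by (intro graph_ladder_graph)
      (auto simp: ladder_edges_def ladder_ends_simps(2)[of 0, simplified] finite_subset
        dest!: Z(2))
  then show ?thesis
    using ladder_stage_ladder_edges[OF W Z(1) m mW] clean_ladderI graph_iso_refl
    unfolding ladder_stage_def by metis
qed


section \<open>The cycle space of a ladder\<close>

text \<open>All ladder graphs share \<open>ladder_ends\<close>, so the parity condition of
  \<open>even_sets\<close> can be stated without naming a graph.\<close>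

definition ladder_even :: "nat set \<Rightarrow> bool" where
  "ladder_even D \<longleftrightarrow> (\<forall>v. (\<Sum>x\<in>D. of_bool (v \<in> ladder_ends x)) = (0 :: bit))"

lemma even_sets_ladder_graph:
  "D \<in> even_sets (ladder_graph V X) \<longleftrightarrow> D \<subseteq> X \<and> ladder_even D"
  by (simp only: even_sets_def cycle_space_def ladder_even_def ladder_graph_simps mem_Collect_eq)

lemma ladder_even_empty: "ladder_even {}"
  by (simp add: ladder_even_def)

lemma ladder_even_sym_diff:
  "finite D \<Longrightarrow> finite D' \<Longrightarrow> ladder_even D \<Longrightarrow> ladder_even D' \<Longrightarrow> ladder_even (sym_diff D D')"
  unfolding ladder_even_def by (simp only: sum_sym_diff_bit add_0 simp_thms)

section \<open>The Hamiltonian cycle and its chords\<close>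

definition ladder_prefix :: "nat \<Rightarrow> nat set" where
  "ladder_prefix j = insert 1 ((\<lambda>i. 5 * i + 3) ` {..<j})"

lemma finite_ladder_prefix: "finite (ladder_prefix j)"
  by (simp add: ladder_prefix_def)

lemma ladder_prefix_Suc: "ladder_prefix (Suc j) = insert (5 * j + 3) (ladder_prefix j)"
  by (auto simp: ladder_prefix_def lessThan_Suc)

lemma in_ladder_prefix: "x \<in> ladder_prefix j \<Longrightarrow> x = 1 \<or> x mod 5 = 3"
  by (auto simp: ladder_prefix_def)

lemma ladder_prefix_mem: "5 * i + 3 \<in> ladder_prefix j \<longleftrightarrow> i < j"
  by (auto simp: ladder_prefix_def)

lemma ladder_ends_1: "ladder_ends 1 = {0, 1}"
  using ladder_ends_simps(2)[of 0] by simp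

text \<open>The prefix is a path with ends \<open>j\<close> and \<open>j + 1\<close>: it starts as
  the edge \<open>{0, 1}\<close>, and each new edge \<open>{j, j + 2}\<close> moves the end
  \<open>j\<close> to \<open>j + 2\<close>.\<close>

lemma sum_ladder_prefix:
  "(\<Sum>x\<in>ladder_prefix j. of_bool (v \<in> ladder_ends x)) = (of_bool (v = j) + of_bool (v = Suc j) :: bit)"
proof (induction j)
  case 0
  have "(\<Sum>x\<in>ladder_prefix 0. of_bool (v \<in> ladder_ends x)) = (of_bool (v \<in> ladder_ends 1) :: bit)"
    by (simp add: ladder_prefix_def)
  then show ?case unfolding ladder_ends_1 by auto
next
  case (Suc j)
  have "5 * j + 3 \<notin> ladder_prefix j" unfolding ladder_prefix_mem by simp
  then have "(\<Sum>x\<in>ladder_prefix (Suc j). of_bool (v \<in> ladder_ends x)) =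
      (of_bool (v \<in> ladder_ends (5 * j + 3)) + (of_bool (v = j) + of_bool (v = Suc j)) :: bit)"
    unfolding ladder_prefix_Suc by (subst sum.insert[OF finite_ladder_prefix]) (simp_all only: Suc.IH not_False_eq_True)
  then show ?case unfolding ladder_ends_simps by auto
qed

lemma ladder_even_rung:
  assumes "0 < j"
  shows "ladder_even (insert (5 * j + 1) (ladder_prefix j))"
  unfolding ladder_even_def
proof
  fix v
  have "5 * j + 1 \<notin> ladder_prefix j" using in_ladder_prefix[of "5 * j + 1" j] assms by auto
  then have "(\<Sum>x\<in>insert (5 * j + 1) (ladder_prefix j). of_bool (v \<in> ladder_ends x)) =
      (of_bool (v \<in> ladder_ends (5 * j + 1)) + (of_bool (v = j) + of_bool (v = Suc j)) :: bit)"
    by (subst sum.insert[OF finite_ladder_prefix]) (simp_all only: sum_ladder_prefix not_False_eq_True)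
  moreover have "ladder_ends (5 * j + 1) = {j, Suc j}" by simp
  ultimately show "(\<Sum>x\<in>insert (5 * j + 1) (ladder_prefix j). of_bool (v \<in> ladder_ends x)) = (0 :: bit)"
    by auto
qed

lemma ladder_even_hamiltonian:
  assumes "0 < m"
  shows "ladder_even (insert (5 * m) (ladder_prefix m))"
  unfolding ladder_even_def
proof
  fix v
  have "5 * m \<notin> ladder_prefix m" using in_ladder_prefix[of "5 * m" m] by auto
  then have "(\<Sum>x\<in>insert (5 * m) (ladder_prefix m). of_bool (v \<in> ladder_ends x)) =
      (of_bool (v \<in> ladder_ends (5 * m)) + (of_bool (v = m) + of_bool (v = Suc m)) :: bit)"
    by (subst sum.insert[OF finite_ladder_prefix]) (simp_all only: sum_ladder_prefix not_False_eq_True)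
  then show "(\<Sum>x\<in>insert (5 * m) (ladder_prefix m). of_bool (v \<in> ladder_ends x)) = (0 :: bit)"
    unfolding ladder_ends_simps by auto
qed

text \<open>The path with ends \<open>k\<close> and \<open>k + 1\<close> is prolonged by
  \<open>{k + 1, k + 3}\<close> and closed by \<open>{k, k + 3}\<close>.\<close>

lemma ladder_even_cross: "ladder_even (insert (5 * k + 4) (insert (5 * Suc k + 3) (ladder_prefix k)))"
  unfolding ladder_even_def
proof
  fix v
  have n: "5 * Suc k + 3 \<notin> ladder_prefix k" unfolding ladder_prefix_mem by simp
  have "5 * k + 4 \<notin> ladder_prefix k" using in_ladder_prefix[of "5 * k + 4" k] by auto
  moreover have "5 * k + 4 \<noteq> 5 * Suc k + 3" by simp
  ultimately have "(\<Sum>x\<in>insert (5 * k + 4) (insert (5 * Suc k + 3) (ladder_prefix k)).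
        of_bool (v \<in> ladder_ends x)) =
      (of_bool (v \<in> ladder_ends (5 * k + 4)) + (of_bool (v \<in> ladder_ends (5 * Suc k + 3)) +
        (of_bool (v = k) + of_bool (v = Suc k))) :: bit)"
    using n by (simp only: sum.insert finite_insert finite_ladder_prefix sum_ladder_prefix insert_iff simp_thms)
  then show "(\<Sum>x\<in>insert (5 * k + 4) (insert (5 * Suc k + 3) (ladder_prefix k)).
        of_bool (v \<in> ladder_ends x)) = (0 :: bit)"
    unfolding ladder_ends_simps by auto
qed

text \<open>If only two edges of \<open>D\<close> can meet \<open>v\<close>, parity at
  \<open>v\<close> forces both or neither.\<close>

lemma ladder_even_two_edges:
  assumes "ladder_even D" "finite D" "x \<noteq> y" "v \<in> ladder_ends x" "v \<in> ladder_ends y"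
    and "\<And>z. z \<in> D \<Longrightarrow> v \<in> ladder_ends z \<Longrightarrow> z = x \<or> z = y"
  shows "x \<in> D \<longleftrightarrow> y \<in> D"
proof -
  have "(\<Sum>z\<in>D. of_bool (v \<in> ladder_ends z)) = (\<Sum>z\<in>D \<inter> {x, y}. of_bool (v \<in> ladder_ends z) :: bit)"
    using assms(2,6) by (intro sum.mono_neutral_right) auto
  also have "\<dots> = of_bool (x \<in> D) + of_bool (y \<in> D)"
    using assms(3-5) by (cases "x \<in> D"; cases "y \<in> D") (auto simp: Int_insert_right)
  finally have "(of_bool (x \<in> D) + of_bool (y \<in> D) :: bit) = 0"
    using assms(1) unfolding ladder_even_def by metis
  then show ?thesis by (cases "x \<in> D"; cases "y \<in> D") auto
qed

text \<open>Every vertex of the cycle meets just two of its edges, so membership in \<open>D\<close>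
  propagates from the edge \<open>1\<close> to all others.\<close>

lemma ladder_even_subset_hamiltonian:
  assumes D: "D \<subseteq> insert (5 * m) (ladder_prefix m)" "ladder_even D" and m: "0 < m"
  shows "D = {} \<or> D = insert (5 * m) (ladder_prefix m)"
proof -
  have fin: "finite D" using D(1) finite_ladder_prefix by (auto intro: finite_subset)
  have cases_D: "z = 1 \<or> z = 5 * m \<or> (\<exists>i<m. z = 5 * i + 3)" if "z \<in> D" for z
    using that D(1) by (auto simp: ladder_prefix_def)
  \<comment> \<open>At vertex \<open>i\<close> the edge \<open>{i, i + 2}\<close> meets the edge
    \<open>1\<close> if \<open>i < 2\<close>, and otherwise \<open>{i - 2, i}\<close>.\<close>
  have step: "5 * i + 3 \<in> D \<longleftrightarrow> 1 \<in> D" if "i < m" for i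
    using that
  proof (induction i rule: less_induct)
    case (less i)
    show ?case
    proof (cases "i < 2")
      case True
      show ?thesis
      proof (rule ladder_even_two_edges[OF D(2) fin, of _ _ i])
        show "i \<in> ladder_ends (5 * i + 3)" by simp
        show "i \<in> ladder_ends 1" using True unfolding ladder_ends_1 by auto
        fix z assume z: "z \<in> D" "i \<in> ladder_ends z"
        show "z = 5 * i + 3 \<or> z = 1"
          using cases_D[OF z(1)]
        proof (elim disjE exE conjE)
          assume "z = 5 * m"
          then show ?thesis using z(2) less.prems by simp
        next
          fix j assume "z = 5 * j + 3"
          then show ?thesis using z(2) True by auto
        qed simp
      qed simp
    next
      case False
      then obtain h where h: "i = h + 2" by (metis add.commute le_Suc_ex not_less)
      have "5 * i + 3 \<in> D \<longleftrightarrow> 5 * h + 3 \<in> D"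
      proof (rule ladder_even_two_edges[OF D(2) fin, of _ _ i])
        show "i \<in> ladder_ends (5 * i + 3)" by simp
        show "i \<in> ladder_ends (5 * h + 3)" using h by simp
        show "5 * i + 3 \<noteq> 5 * h + 3" using h by simp
        fix z assume z: "z \<in> D" "i \<in> ladder_ends z"
        show "z = 5 * i + 3 \<or> z = 5 * h + 3"
          using cases_D[OF z(1)]
        proof (elim disjE exE conjE)
          assume "z = 1"
          then have "i \<in> {0, 1}" using z(2) ladder_ends_1 by metis
          then show ?thesis using False by auto
        next
          assume "z = 5 * m"
          then show ?thesis using z(2) less.prems by simp
        next
          fix j assume "z = 5 * j + 3"
          then show ?thesis using z(2) h by auto
        qed
      qed
      then show ?thesis using less.IH[of h] less.prems h by simp
    qed
  qed
  have "5 * m \<in> D \<longleftrightarrow> 5 * (m - 1) + 3 \<in> D"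
  proof (rule ladder_even_two_edges[OF D(2) fin, of _ _ "Suc m"])
    show "5 * m \<noteq> 5 * (m - 1) + 3" using m by presburger
    show "Suc m \<in> ladder_ends (5 * m)" by simp
    show "Suc m \<in> ladder_ends (5 * (m - 1) + 3)" unfolding ladder_ends_simps using m by simp
    fix z assume z: "z \<in> D" "Suc m \<in> ladder_ends z"
    show "z = 5 * m \<or> z = 5 * (m - 1) + 3"
      using cases_D[OF z(1)]
    proof (elim disjE exE conjE)
      assume "z = 1"
      then have "Suc m \<in> {0, 1}" using z(2) ladder_ends_1 by metis
      then show ?thesis using m by auto
    next
      fix j assume j: "j < m" "z = 5 * j + 3"
      then have "Suc m = j + 2" using z(2) by auto
      then show ?thesis using j by simp
    qed simp
  qed
  then have top: "5 * m \<in> D \<longleftrightarrow> 1 \<in> D" using step[of "m - 1"] m by simp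
  show ?thesis
  proof (cases "1 \<in> D")
    case True
    then have "insert (5 * m) (ladder_prefix m) \<subseteq> D"
      using top step by (auto simp: ladder_prefix_def)
    then show ?thesis using D(1) by blast
  next
    case False
    then have "z \<notin> D" for z using cases_D[of z] top step by blast
    then show ?thesis by blast
  qed
qed


section \<open>Set families with at most two members per level\<close>

text \<open>The list is built from its end: the last entry is an element that all members other than
  \<open>S\<close> avoid.\<close>

lemma chain_enumeration:
  assumes "finite S" "\<And>A. A \<in> \<C> \<Longrightarrow> A \<subseteq> S"
    and "\<And>A B. A \<in> \<C> \<Longrightarrow> B \<in> \<C> \<Longrightarrow> A \<subseteq> B \<or> B \<subseteq> A"
  shows "\<exists>xs. distinct xs \<and> set xs = S \<and> (\<forall>A\<in>\<C>. A = set (take (card A) xs))"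
  using assms
proof (induction "card S" arbitrary: S \<C>)
  case 0
  then show ?case by (intro exI[of _ "[]"]) auto
next
  case (Suc n)
  \<comment> \<open>The members other than \<open>S\<close> form a chain; if there are any, take an
    element outside the largest of them.\<close>
  have "\<exists>x\<in>S. \<forall>A\<in>\<C> - {S}. A \<subseteq> S - {x}"
  proof (cases "\<C> - {S} = {}")
    case True
    have "S \<noteq> {}" using Suc.hyps(2) by auto
    then show ?thesis unfolding True by blast
  next
    case False
    have "finite (\<C> - {S})"
      using Suc.prems(1) Suc.prems(2) by (blast intro: finite_subset[of _ "Pow S"])
    then obtain T where T: "T \<in> \<C> - {S}" "\<And>A. A \<in> \<C> - {S} \<Longrightarrow> T \<subseteq> A \<Longrightarrow> T = A"
      using finite_has_maximal[of "\<C> - {S}"] False by blast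
    then obtain x where "x \<in> S - T" using Suc.prems(2)[of T] by blast
    moreover have "A \<subseteq> T" if "A \<in> \<C> - {S}" for A
      using Suc.prems(3)[of A T] T that by blast
    ultimately show ?thesis using Suc.prems(2) by blast
  qed
  then obtain x where x: "x \<in> S" "\<And>A. A \<in> \<C> - {S} \<Longrightarrow> A \<subseteq> S - {x}" by blast
  have "n = card (S - {x})" using Suc.hyps(2) Suc.prems(1) x(1) by simp
  then have "\<exists>xs. distinct xs \<and> set xs = S - {x} \<and> (\<forall>A\<in>\<C> - {S}. A = set (take (card A) xs))"
    using Suc.prems(1,3) x(2) by (intro Suc.hyps(1)) auto
  then obtain xs where xs: "distinct xs" "set xs = S - {x}"
    "\<forall>A\<in>\<C> - {S}. A = set (take (card A) xs)" by (elim exE conjE)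
  have len: "length xs = card (S - {x})" using xs(1,2) distinct_card by metis
  have "A = set (take (card A) (xs @ [x]))" if A: "A \<in> \<C>" for A
  proof (cases "A = S")
    case True
    have "length (xs @ [x]) = card S" using len Suc.prems(1) x(1) Suc.hyps(2) by simp
    then show ?thesis using True xs(2) x(1) by auto
  next
    case False
    then have "card A \<le> length xs"
      unfolding len using x(2)[of A] A Suc.prems(1) by (intro card_mono) auto
    moreover have "A = set (take (card A) xs)" using xs(3) A False by (intro bspec[OF xs(3)]) simp
    ultimately show ?thesis by simp
  qed
  moreover have "distinct (xs @ [x])" "set (xs @ [x]) = S" using xs(1,2) x(1) by auto
  ultimately show ?case by (intro exI[of _ "xs @ [x]"] conjI ballI)
qed

text \<open>
  One member from each level together with the intersection and the union of every pair of members
  on the same level form a chain; the enumeration refines it.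
\<close>

lemma two_per_level_enumeration:
  assumes fin: "finite S" and sub: "\<And>A. A \<in> \<A> \<Longrightarrow> A \<subseteq> S"
    and pair: "\<And>A B. A \<in> \<A> \<Longrightarrow> B \<in> \<A> \<Longrightarrow>
      A \<subseteq> B \<or> B \<subseteq> A \<or> (\<exists>a b. A - B = {a} \<and> B - A = {b})"
    and triple: "\<And>A B D. A \<in> \<A> \<Longrightarrow> B \<in> \<A> \<Longrightarrow> D \<in> \<A> \<Longrightarrow> card A = card B \<Longrightarrow> card A = card D \<Longrightarrow>
      A = B \<or> A = D \<or> B = D"
  obtains xs where "distinct xs" "set xs = S"
    "\<And>A. A \<in> \<A> \<Longrightarrow> A = set (take (card A) xs) \<or>
      (0 < card A \<and> card A < length xs \<and> set (take (card A) xs) \<in> \<A> \<and>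
       A = insert (xs ! card A) (set (take (card A - 1) xs)))"
proof -
  have finA: "finite A" if "A \<in> \<A>" for A using sub[OF that] fin by (rule finite_subset)
  have card_diff: "card A = card (A \<inter> B) + card (A - B)" if "A \<in> \<A>" for A B
    using finA[OF that] by (metis card_Int_Diff)
  \<comment> \<open>Incomparable members differ by exchanging one element, so they have the same
    size.\<close>
  have lt: "A \<subseteq> B" if A: "A \<in> \<A>" and B: "B \<in> \<A>" and less: "card A < card B" for A B
  proof (rule ccontr)
    assume "\<not> A \<subseteq> B"
    then consider "B \<subseteq> A" | a b where "A - B = {a}" "B - A = {b}" using pair[OF A B] by blast
    then show False
    proof cases
      case 1
      then show False using card_mono[OF finA[OF A], of B] less by simp
    next
      case 2
      then show False
        using card_diff[OF A, of B] card_diff[OF B, of A] less by (simp add: Int_commute)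
    qed
  qed
  define rep where "rep k = (SOME A. A \<in> \<A> \<and> card A = k)" for k
  have rep: "rep (card A) \<in> \<A>" "card (rep (card A)) = card A" if "A \<in> \<A>" for A
    using someI[of "\<lambda>B. B \<in> \<A> \<and> card B = card A" A] that unfolding rep_def by simp_all
  \<comment> \<open>The disjunct \<open>A = rep k\<close> (with \<open>A = B\<close>) admits the
    representative when it is alone on its level.\<close>
  define level where "level k = {X. \<exists>A B. A \<in> \<A> \<and> B \<in> \<A> \<and> card A = k \<and> card B = k \<and>
    (A \<noteq> B \<or> A = rep k) \<and> (X = rep k \<or> X = A \<inter> B \<and> A \<noteq> B \<or> X = A \<union> B \<and> A \<noteq> B)}" for k
  have between: "\<exists>A\<in>\<A>. \<exists>B\<in>\<A>. card A = k \<and> card B = k \<and> A \<inter> B \<subseteq> X \<and> X \<subseteq> A \<union> B"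
    if X: "X \<in> level k" for X k
  proof -
    obtain A B where AB: "A \<in> \<A>" "B \<in> \<A>" "card A = k" "card B = k"
      "X = rep k \<or> X = A \<inter> B \<or> X = A \<union> B" using X unfolding level_def by blast
    show ?thesis
    proof (cases "X = rep k")
      case True
      then show ?thesis using rep[OF AB(1)] AB(3) by blast
    next
      case False
      then show ?thesis using AB by blast
    qed
  qed
  have below: "X \<subseteq> Y" if X: "X \<in> level k" and Y: "Y \<in> level l" and kl: "k < l" for X Y k l
  proof -
    obtain A B where AB: "A \<in> \<A>" "B \<in> \<A>" "card A = k" "card B = k" "X \<subseteq> A \<union> B"
      using between[OF X] by blast
    obtain A' B' where AB': "A' \<in> \<A>" "B' \<in> \<A>" "card A' = l" "card B' = l" "A' \<inter> B' \<subseteq> Y"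
      using between[OF Y] by blast
    have "A \<subseteq> A'" "A \<subseteq> B'" "B \<subseteq> A'" "B \<subseteq> B'" using AB(1-4) AB'(1-4) kl by (simp_all add: lt)
    then show ?thesis using AB(5) AB'(5) by blast
  qed
  \<comment> \<open>By \<open>triple\<close> a level has at most one pair of distinct members, and
    \<open>rep k\<close> is one of the two; so intersection, representative and union are
    nested.\<close>
  have same: "X \<subseteq> Y \<or> Y \<subseteq> X" if X: "X \<in> level k" and Y: "Y \<in> level k" for X Y k
  proof -
    obtain A B where AB: "A \<in> \<A>" "B \<in> \<A>" "card A = k" "card B = k"
      "X = rep k \<or> X = A \<inter> B \<and> A \<noteq> B \<or> X = A \<union> B \<and> A \<noteq> B" using X unfolding level_def by blast
    obtain A' B' where AB': "A' \<in> \<A>" "B' \<in> \<A>" "card A' = k" "card B' = k"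
      "Y = rep k \<or> Y = A' \<inter> B' \<and> A' \<noteq> B' \<or> Y = A' \<union> B' \<and> A' \<noteq> B'" using Y unfolding level_def by blast
    have r: "rep k \<in> \<A>" "card (rep k) = k" using rep[OF AB(1)] AB(3) by auto
    have rAB: "A = B \<or> rep k = A \<or> rep k = B" using triple[of A B "rep k"] AB r by auto
    have rAB': "A' = B' \<or> rep k = A' \<or> rep k = B'" using triple[of A' B' "rep k"] AB' r by auto
    have "A = B \<or> A' = B' \<or> (A' = A \<or> A' = B)" using triple[of A B A'] AB AB' by auto
    moreover have "A = B \<or> A' = B' \<or> (B' = A \<or> B' = B)" using triple[of A B B'] AB AB' by auto
    ultimately show ?thesis using rAB rAB' AB(5) AB'(5) by blast
  qed
  have level_sub: "X \<subseteq> S" if "X \<in> level k" for X k using between[OF that] sub by blast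
  have "\<exists>xs. distinct xs \<and> set xs = S \<and> (\<forall>X\<in>\<Union>(range level). X = set (take (card X) xs))"
  proof (rule chain_enumeration[OF fin])
    fix X Y assume "X \<in> \<Union>(range level)" "Y \<in> \<Union>(range level)"
    then obtain k l where "X \<in> level k" "Y \<in> level l" by blast
    then show "X \<subseteq> Y \<or> Y \<subseteq> X"
      using below same by (cases k l rule: linorder_cases) blast+
  qed (use level_sub in blast)
  then obtain xs where xs: "distinct xs" "set xs = S"
    and prefix': "\<forall>X\<in>\<Union>(range level). X = set (take (card X) xs)" by (elim exE conjE)
  have prefix: "X = set (take (card X) xs)" if "X \<in> level k" for X k
    using that by (intro bspec[OF prefix']) blast
  show ?thesis
  proof (rule that[OF xs])
    fix A assume A: "A \<in> \<A>"
    define k where "k = card A"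
    define R where "R = rep k"
    have R: "R \<in> \<A>" "card R = k" using rep[OF A] by (auto simp: R_def k_def)
    have "R \<in> level k" using R by (auto simp: level_def R_def)
    then have R_prefix: "R = set (take k xs)" using prefix[of R k] R(2) by simp
    show "A = set (take (card A) xs) \<or>
      (0 < card A \<and> card A < length xs \<and> set (take (card A) xs) \<in> \<A> \<and>
       A = insert (xs ! card A) (set (take (card A - 1) xs)))"
    proof (cases "A = R")
      case False
      \<comment> \<open>\<open>A \<inter> R\<close>, \<open>R\<close> and
        \<open>A \<union> R\<close> are the prefixes of lengths \<open>k - 1\<close>,
        \<open>k\<close> and \<open>k + 1\<close>. Hence \<open>A\<close> omits the entry with index
        \<open>k - 1\<close> and takes the one with index \<open>k\<close>.\<close>
      have "\<not> A \<subseteq> R" "\<not> R \<subseteq> A"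
        using False card_subset_eq[OF finA[OF A], of R] card_subset_eq[OF finA[OF R(1)], of A]
          R(2) by (auto simp: k_def)
      then obtain a b where ab: "A - R = {a}" "R - A = {b}" using pair[OF A R(1)] by blast
      have cap: "A \<inter> R \<in> level k" "A \<union> R \<in> level k"
        using A R False by (auto simp: level_def k_def)
      have ck: "k = Suc (card (A \<inter> R))" using card_diff[OF A, of R] ab by (simp add: k_def)
      have "A \<union> R = insert a R" "a \<notin> R" using ab by auto
      then have cu: "card (A \<union> R) = Suc k" using R finA by simp
      have "A \<union> R \<subseteq> S" using A R sub by blast
      then have "Suc k \<le> length xs"
        using cu card_mono[OF fin, of "A \<union> R"] xs distinct_card[of xs] by simp
      then have kl: "k < length xs" by simp
      have "A \<union> R = set (take (Suc k) xs)" using prefix[OF cap(2)] cu by simp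
      also have "\<dots> = insert (xs ! k) R" using kl R_prefix by (simp add: take_Suc_conv_app_nth)
      finally have a: "a = xs ! k" using \<open>A \<union> R = insert a R\<close> \<open>a \<notin> R\<close> by blast
      have cap_prefix: "A \<inter> R = set (take (k - 1) xs)" using prefix[OF cap(1)] ck by simp
      have "A = insert a (A \<inter> R)" using ab by blast
      then have "A = insert (xs ! k) (set (take (k - 1) xs))" unfolding a cap_prefix .
      moreover have "0 < k" using ck by simp
      ultimately show ?thesis
        using R(1) kl unfolding R_prefix k_def[symmetric] by (intro disjI2 conjI)
    next
      case True
      then show ?thesis using R_prefix unfolding k_def by (intro disjI1) (rule trans)
    qed
  qed
qed


section \<open>Matroids in which all circuits through two elements span\<close>

lemma circuit_indep_remove: "circuit M C \<Longrightarrow> x \<in> C \<Longrightarrow> indep M (C - {x})"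
  by (auto simp: circuit_def)

lemma (in matroid) rank_circuit:
  assumes "circuit M C"
  shows "card C = Suc (rank M C)"
proof -
  have C: "C \<subseteq> ground M" "\<not> indep M C" using assms by (auto simp: circuit_def)
  have fin: "finite C" using C(1) finite_ground by (rule finite_subset)
  obtain x where x: "x \<in> C" using C(2) indep_empty by (cases "C = {}") auto
  have "rank M C = card (C - {x})"
    unfolding rank_def
  proof (rule Max_eqI)
    show "finite (card ` {Y. Y \<subseteq> C \<and> indep M Y})" using fin by simp
    show "card (C - {x}) \<in> card ` {Y. Y \<subseteq> C \<and> indep M Y}"
      using circuit_indep_remove[OF assms x] by auto
    fix k assume "k \<in> card ` {Y. Y \<subseteq> C \<and> indep M Y}"
    then obtain Y where Y: "k = card Y" "Y \<subseteq> C" "indep M Y" by auto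
    then have "Y \<subset> C" using C(2) by auto
    then have "card Y < card C" using fin psubset_card_mono by blast
    then show "k \<le> card (C - {x})" using Y(1) x fin by simp
  qed
  then show ?thesis using card_Suc_Diff1[OF fin x] by metis
qed

lemma (in matroid) card_le_rank_ground:
  assumes "indep M X"
  shows "card X \<le> rank M (ground M)"
proof -
  have "finite {Y. Y \<subseteq> ground M \<and> indep M Y}" using finite_ground by simp
  then show ?thesis
    unfolding rank_def using assms indep_subset_ground by (intro Max_ge) auto
qed

text \<open>Keeps only what is needed of a GF(2) representation: its cycle space \<open>Z\<close>,
  closed under symmetric difference.\<close>

locale binary_matroid = matroid M for M :: "'e pre_matroid" +
  fixes Z :: "'e set set"
  assumes Z_subset: "D \<in> Z \<Longrightarrow> D \<subseteq> ground M"
    and Z_sym_diff: "D \<in> Z \<Longrightarrow> D' \<in> Z \<Longrightarrow> sym_diff D D' \<in> Z"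
    and indep_iff: "X \<subseteq> ground M \<Longrightarrow> indep M X \<longleftrightarrow> (\<forall>D\<in>Z. D \<subseteq> X \<longrightarrow> D = {})"
begin

lemma circuit_iff: "circuit M C \<longleftrightarrow> C \<in> Z \<and> C \<noteq> {} \<and> (\<forall>D\<in>Z. D \<subset> C \<longrightarrow> D = {})"
  using indep_iff Z_subset by (rule circuit_iff_minimal)

lemma circuit_in_Z: "circuit M C \<Longrightarrow> C \<in> Z"
  by (simp add: circuit_iff)

lemma circuit_minimal: "circuit M C \<Longrightarrow> D \<in> Z \<Longrightarrow> D \<subseteq> C \<Longrightarrow> D = {} \<or> D = C"
  unfolding circuit_iff by blast

text \<open>Adding \<open>C\<close> exchanges the two sides of the chord \<open>z\<close>.\<close>

lemma insert_complement_in_Z: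
  assumes "circuit M C" "A \<subseteq> C" "z \<notin> C" "insert z A \<in> Z"
  shows "insert z (C - A) \<in> Z"
proof -
  have "sym_diff (insert z A) C = insert z (C - A)" using assms(2,3) by blast
  then show ?thesis using Z_sym_diff[OF assms(4) circuit_in_Z[OF assms(1)]] by simp
qed

text \<open>A smaller member of \<open>Z\<close> would, possibly after adding
  \<open>insert z A\<close>, become a member properly inside the circuit \<open>C\<close>.\<close>

lemma circuit_insert:
  assumes C: "circuit M C" and A: "A \<subset> C" "A \<noteq> {}" "z \<notin> C" "insert z A \<in> Z"
  shows "circuit M (insert z A)"
  unfolding circuit_iff
proof (intro conjI ballI impI)
  fix D assume D: "D \<in> Z" "D \<subset> insert z A"
  show "D = {}"
  proof (cases "z \<in> D")
    case True
    have "sym_diff D (insert z A) \<subset> C" using True D(2) A(1) by blast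
    then have "sym_diff D (insert z A) = {}"
      using circuit_minimal[OF C Z_sym_diff[OF D(1) A(4)]] by blast
    then show ?thesis using D(2) by blast
  next
    case False
    then have "D \<subset> C" using D(2) A(1) by blast
    then show ?thesis using circuit_minimal[OF C D(1)] by blast
  qed
qed (use A in auto)

lemma simple_card_ge_3:
  assumes "simple_matroid M" "D \<in> Z" "D \<noteq> {}"
  shows "3 \<le> card D"
proof -
  have fin: "finite D" using Z_subset[OF assms(2)] finite_ground by (rule finite_subset)
  then have "finite {C \<in> Z. C \<subseteq> D \<and> C \<noteq> {}}" by (auto intro: finite_subset[of _ "Pow D"])
  moreover have "{C \<in> Z. C \<subseteq> D \<and> C \<noteq> {}} \<noteq> {}" using assms by blast
  ultimately obtain C where C: "C \<in> Z" "C \<subseteq> D" "C \<noteq> {}"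
    "\<forall>B\<in>{C \<in> Z. C \<subseteq> D \<and> C \<noteq> {}}. B \<subseteq> C \<longrightarrow> C = B"
    using finite_has_minimal[of "{C \<in> Z. C \<subseteq> D \<and> C \<noteq> {}}"] by blast
  have "B = {}" if "B \<in> Z" "B \<subset> C" for B using C(2,4) that by blast
  then have "circuit M C" using C unfolding circuit_iff by blast
  then have "3 \<le> card C" using assms(1) by (simp add: simple_matroid_def)
  then show ?thesis using card_mono[OF fin C(2)] by simp
qed

end

text \<open>A second representation \<open>B\<close> of the same matroid, over the rationals; the
  interplay with \<open>Z\<close> is what rules out the Fano configuration.\<close>

locale regular_representation = binary_matroid M Z for M :: "'e pre_matroid" and Z +
  fixes B :: "nat \<Rightarrow> 'e \<Rightarrow> rat"
  assumes indep_iff_rat: "X \<subseteq> ground M \<Longrightarrow> indep M X \<longleftrightarrow> lin_indep B X"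
begin

definition relation :: "'e set \<Rightarrow> ('e \<Rightarrow> rat) \<Rightarrow> bool" where
  "relation X c \<longleftrightarrow> (\<forall>i. (\<Sum>x\<in>X. c x * B i x) = 0)"

lemma dependent_relation:
  assumes "X \<subseteq> ground M" "\<not> indep M X"
  obtains c where "relation X c" "\<exists>x\<in>X. c x \<noteq> 0"
  using assms indep_iff_rat[of X] unfolding lin_indep_def relation_def by blast

lemma indep_relation:
  assumes "indep M X" "relation X c" "x \<in> X"
  shows "c x = 0"
  using assms indep_iff_rat[of X] indep_subset_ground[of X] unfolding lin_indep_def relation_def by blast

lemma circuit_relation_zero:
  assumes C: "circuit M C" and c: "relation C c" and y: "y \<in> C" "c y = 0" and x: "x \<in> C"
  shows "c x = 0"
proof (cases "x = y")
  case False
  have fin: "finite C" using C finite_ground by (auto simp: circuit_def intro: finite_subset)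
  have "relation (C - {y}) c"
    using c y fin by (simp add: relation_def sum.remove[OF fin y(1)])
  then show ?thesis
    using indep_relation[OF circuit_indep_remove[OF C y(1)], of c x] x False by simp
qed (use y in simp)

lemma circuit_relation:
  assumes "circuit M C"
  obtains c where "relation C c" "\<And>x. x \<in> C \<Longrightarrow> c x \<noteq> 0"
proof -
  have "C \<subseteq> ground M" "\<not> indep M C" using assms by (auto simp: circuit_def)
  then obtain c where "relation C c" "\<exists>x\<in>C. c x \<noteq> 0" by (rule dependent_relation)
  then show ?thesis using circuit_relation_zero[OF assms] that by blast
qed

text \<open>The relations on a circuit form a line: subtract the multiple of \<open>c\<close> that
  makes the difference vanish at one element; it then vanishes everywhere.\<close>

lemma circuit_relation_unique:
  assumes C: "circuit M C" and c: "relation C c" "\<And>x. x \<in> C \<Longrightarrow> c x \<noteq> 0" and d: "relation C d"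
  obtains t where "\<And>x. x \<in> C \<Longrightarrow> d x = t * c x"
proof (cases "C = {}")
  case False
  then obtain y where y: "y \<in> C" by blast
  define t where "t = d y / c y"
  have "relation C (\<lambda>x. d x - t * c x)"
    using c(1) d
    by (simp add: relation_def left_diff_distrib sum_subtractf mult.assoc flip: sum_distrib_left)
  moreover have "d y - t * c y = 0" using c(2)[OF y] by (simp add: t_def)
  ultimately have "d x - t * c x = 0" if "x \<in> C" for x
    using circuit_relation_zero[OF C, of "\<lambda>x. d x - t * c x" y x] y that by blast
  then show ?thesis using that[of t] by simp
qed (use that in blast)

text \<open>The column of \<open>z\<close> is spanned by either side of the chord. The difference of
  the two expressions is a relation on \<open>C\<close>, hence proportional to \<open>c\<close>; so
  up to a scalar the column is the partial sum of \<open>c\<close> over \<open>A\<close>.\<close>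

lemma chord_vector:
  assumes C: "circuit M C" and c: "relation C c" "\<And>x. x \<in> C \<Longrightarrow> c x \<noteq> 0"
    and A: "A \<subset> C" "A \<noteq> {}" and z: "z \<notin> C" "insert z A \<in> Z"
  obtains t where "t \<noteq> 0" "\<And>i. B i z = t * (\<Sum>x\<in>A. c x * B i x)"
proof -
  have fin: "finite C" using C finite_ground by (auto simp: circuit_def intro: finite_subset)
  \<comment> \<open>The relation on the circuit \<open>insert z A\<close>, solved for the column of
    \<open>z\<close>.\<close>
  have span: "\<exists>a. (\<forall>x\<in>A. a x \<noteq> 0) \<and> (\<forall>i. B i z = (\<Sum>x\<in>A. a x * B i x))"
    if A: "A \<subset> C" "A \<noteq> {}" "insert z A \<in> Z" for A
  proof -
    obtain a where a: "relation (insert z A) a" "\<And>x. x \<in> insert z A \<Longrightarrow> a x \<noteq> 0"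
      using circuit_relation[OF circuit_insert[OF C A(1,2) z(1) A(3)]] by blast
    have "finite A" "z \<notin> A" using A(1) z(1) fin by (auto intro: finite_subset)
    then have "a z * B i z + (\<Sum>x\<in>A. a x * B i x) = 0" for i
      using a(1) by (simp add: relation_def)
    then have "B i z = (\<Sum>x\<in>A. (- a x / a z) * B i x)" for i
      using a(2)[of z] by (simp add: sum_negf sum_divide_distrib[symmetric] field_simps add_eq_0_iff2)
    then show ?thesis using a(2) by (intro exI[of _ "\<lambda>x. - a x / a z"]) auto
  qed
  obtain a where a: "\<And>x. x \<in> A \<Longrightarrow> a x \<noteq> 0" "\<And>i. B i z = (\<Sum>x\<in>A. a x * B i x)"
    using span[OF A z(2)] by blast
  obtain b where b: "\<And>i. B i z = (\<Sum>x\<in>C - A. b x * B i x)"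
    using span[of "C - A"] insert_complement_in_Z[OF C _ z] A by blast
  have "(\<Sum>x\<in>C. (if x \<in> A then a x else - b x) * B i x) = 0" for i
  proof -
    have "(\<Sum>x\<in>C. (if x \<in> A then a x else - b x) * B i x) =
        (\<Sum>x\<in>A. (if x \<in> A then a x else - b x) * B i x) +
        (\<Sum>x\<in>C - A. (if x \<in> A then a x else - b x) * B i x)"
      using fin A(1) by (subst add.commute, intro sum.subset_diff) auto
    also have "\<dots> = (\<Sum>x\<in>A. a x * B i x) - (\<Sum>x\<in>C - A. b x * B i x)"
      by (simp add: sum_negf)
    finally show ?thesis using a(2) b by simp
  qed
  then have "relation C (\<lambda>x. if x \<in> A then a x else - b x)" by (simp add: relation_def)
  then obtain t where t: "\<And>x. x \<in> C \<Longrightarrow> (if x \<in> A then a x else - b x) = t * c x"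
    using circuit_relation_unique[OF C c] by blast
  have at: "a x = t * c x" if "x \<in> A" for x using t[of x] that A(1) by auto
  obtain x where "x \<in> A" using A(2) by blast
  then have "t \<noteq> 0" using a(1) at by force
  moreover have "B i z = t * (\<Sum>x\<in>A. c x * B i x)" for i
    unfolding a(2) sum_distrib_left by (intro sum.cong) (simp_all add: at mult.assoc)
  ultimately show ?thesis by (rule that)
qed

text \<open>The four elements outside the dependent set \<open>D\<close> of the proof witness a Fano minor, whose
  dependencies force \<open>3 = 1\<close>.\<close>

lemma no_fano:
  assumes C: "circuit M C"
    and A: "A1 \<subset> C" "A2 \<subset> C" "A3 \<subset> C"
    and z: "z1 \<notin> C" "z2 \<notin> C" "z3 \<notin> C" "distinct [z1, z2, z3]"
    and Z: "insert z1 A1 \<in> Z" "insert z2 A2 \<in> Z" "insert z3 A3 \<in> Z"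
    and a: "a1 \<in> A1 - A2 - A3" "a2 \<in> A2 - A1 - A3" "a3 \<in> A3 - A1 - A2" "g \<in> A1 \<inter> A2 \<inter> A3"
  shows False
proof -
  have fin: "finite C" using C finite_ground by (auto simp: circuit_def intro: finite_subset)
  obtain c where c: "relation C c" "\<And>x. x \<in> C \<Longrightarrow> c x \<noteq> 0" using circuit_relation[OF C] by blast
  obtain t1 where t1: "t1 \<noteq> 0" "\<And>i. B i z1 = t1 * (\<Sum>x\<in>A1. c x * B i x)"
    using chord_vector[OF C c A(1) _ z(1) Z(1)] a by blast
  obtain t2 where t2: "t2 \<noteq> 0" "\<And>i. B i z2 = t2 * (\<Sum>x\<in>A2. c x * B i x)"
    using chord_vector[OF C c A(2) _ z(2) Z(2)] a by blast
  obtain t3 where t3: "t3 \<noteq> 0" "\<And>i. B i z3 = t3 * (\<Sum>x\<in>A3. c x * B i x)"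
    using chord_vector[OF C c A(3) _ z(3) Z(3)] a by blast
  \<comment> \<open>The sum of the three chord circuits and \<open>C\<close> is \<open>D\<close>, so
    \<open>D\<close> is dependent. The elements \<open>a1\<close>, \<open>a2\<close>,
    \<open>a3\<close> and \<open>g\<close> lie in an odd number of the three sides, hence in
    \<open>S\<close> and outside \<open>D\<close>.\<close>
  define S where "S = sym_diff (sym_diff A1 A2) A3"
  define D where "D = {z1, z2, z3} \<union> (C - S)"
  have "D = sym_diff (sym_diff (sym_diff (insert z1 A1) (insert z2 A2)) (insert z3 A3)) C"
    using A z unfolding D_def S_def by auto
  then have "D \<in> Z" using Z circuit_in_Z[OF C] by (simp add: Z_sym_diff)
  then have "\<not> indep M D" "D \<subseteq> ground M"
    using indep_iff[of D] Z_subset[of D] by (auto simp: D_def)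
  then obtain l where l: "relation D l" "\<exists>x\<in>D. l x \<noteq> 0" by (blast elim: dependent_relation)
  \<comment> \<open>Replacing the columns of the three chords by partial sums of \<open>c\<close>
    turns the relation \<open>l\<close> on \<open>D\<close> into a relation on \<open>C\<close>,
    which must be \<open>t * c\<close>.\<close>
  define d where "d x = of_bool (x \<notin> S) * l x + l z1 * t1 * (of_bool (x \<in> A1) * c x) +
    l z2 * t2 * (of_bool (x \<in> A2) * c x) + l z3 * t3 * (of_bool (x \<in> A3) * c x)" for x
  have "(\<Sum>x\<in>C. d x * B i x) = 0" for i
  proof -
    have part: "(\<Sum>x\<in>C. of_bool (x \<in> A) * c x * B i x) = (\<Sum>x\<in>A. c x * B i x)" if "A \<subset> C" for A
      using that fin by (intro sum.mono_neutral_cong_right) auto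
    have rest: "(\<Sum>x\<in>C. of_bool (x \<notin> S) * l x * B i x) = (\<Sum>x\<in>C - S. l x * B i x)"
      using fin by (intro sum.mono_neutral_cong_right) auto
    have "(\<Sum>x\<in>C. d x * B i x) = (\<Sum>x\<in>C - S. l x * B i x) + l z1 * (t1 * (\<Sum>x\<in>A1. c x * B i x)) +
        l z2 * (t2 * (\<Sum>x\<in>A2. c x * B i x)) + l z3 * (t3 * (\<Sum>x\<in>A3. c x * B i x))"
      unfolding rest[symmetric] part[OF A(1), symmetric] part[OF A(2), symmetric]
        part[OF A(3), symmetric] d_def
      by (simp add: sum.distrib distrib_right sum_distrib_left mult.assoc)
    also have "\<dots> = (\<Sum>x\<in>C - S. l x * B i x) + l z1 * B i z1 + l z2 * B i z2 + l z3 * B i z3"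
      by (simp only: t1(2) t2(2) t3(2))
    also have "\<dots> = (\<Sum>x\<in>D. l x * B i x)"
      using z fin by (simp add: D_def)
    finally show ?thesis using l(1) by (simp add: relation_def)
  qed
  then have "relation C d" by (simp add: relation_def)
  then obtain t where t: "\<And>x. x \<in> C \<Longrightarrow> d x = t * c x"
    using circuit_relation_unique[OF C c] by blast
  have aC: "a1 \<in> C" "a2 \<in> C" "a3 \<in> C" "g \<in> C" using A a by auto
  \<comment> \<open>Each of \<open>a1\<close>, \<open>a2\<close>, \<open>a3\<close> sees one chord
    only, so each chord contributes \<open>t\<close>; at \<open>g\<close> all three contribute, and
    3 t = t.\<close>
  have "l z1 * t1 * c a1 = t * c a1" "l z2 * t2 * c a2 = t * c a2" "l z3 * t3 * c a3 = t * c a3"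
    using t[OF aC(1)] t[OF aC(2)] t[OF aC(3)] a by (simp_all add: d_def S_def)
  then have lt: "l z1 * t1 = t" "l z2 * t2 = t" "l z3 * t3 = t" using c(2) aC by simp_all
  have "t * c g + t * c g + t * c g = t * c g"
    using t[OF aC(4)] a by (simp add: d_def S_def lt)
  then have "t = 0" using c(2)[OF aC(4)] by simp
  then have zero: "l z1 = 0" "l z2 = 0" "l z3 = 0" using lt t1(1) t2(1) t3(1) by auto
  have "l x = 0" if "x \<in> C - S" for x
    using t[of x] that zero \<open>t = 0\<close> by (simp add: d_def)
  then show False using l(2) zero by (auto simp: D_def)
qed

end

text \<open>The fixed circuit \<open>C\<close> becomes the Hamiltonian cycle of the ladder; all
  other elements are read off as chords of it.\<close>

locale spanning_pair = regular_representation M Z B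
  for M :: "'e pre_matroid" and Z B +
  fixes e f :: 'e and C :: "'e set"
  assumes simple: "simple_matroid M"
    and C: "circuit M C" and e: "e \<in> C" and f: "f \<in> C" and ef: "e \<noteq> f"
    and pair_spanning: "\<And>D. circuit M D \<Longrightarrow> e \<in> D \<Longrightarrow> f \<in> D \<Longrightarrow> spanning M D"
begin

section \<open>Chords of the spanning circuit\<close>

lemma finite_C: "finite C"
  using C finite_ground by (auto simp: circuit_def intro: finite_subset)

text \<open>A spanning circuit has one element more than the rank of \<open>M\<close>.\<close>

lemma card_circuit_through_pair:
  assumes "circuit M D" "e \<in> D" "f \<in> D"
  shows "card D = card C"
  using pair_spanning[OF assms] pair_spanning[OF C e f] rank_circuit[OF assms(1)] rank_circuit[OF C]
  by (simp add: spanning_def)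

lemma chord_exists:
  assumes z: "z \<in> ground M - C"
  shows "\<exists>A\<subseteq>C. e \<in> A \<and> f \<notin> A \<and> insert z A \<in> Z"
proof -
  \<comment> \<open>\<open>T\<close> has as many elements as \<open>C\<close>, more than the rank,
    so it contains a nonempty member of \<open>Z\<close>; this contains \<open>z\<close> and misses
    \<open>f\<close>.\<close>
  define T where "T = insert z (C - {f})"
  have "card T = Suc (card (C - {f}))" unfolding T_def using z finite_C by simp
  then have "card T = card C" using card_Suc_Diff1[OF finite_C f] by simp
  moreover have "card C = Suc (rank M (ground M))"
    using rank_circuit[OF C] pair_spanning[OF C e f] by (simp add: spanning_def)
  ultimately have "\<not> indep M T" using card_le_rank_ground[of T] by auto
  moreover have "T \<subseteq> ground M" using z C by (auto simp: T_def circuit_def)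
  ultimately obtain D where D: "D \<in> Z" "D \<subseteq> T" "D \<noteq> {}" using indep_iff[of T] by blast
  have zD: "z \<in> D"
  proof (rule ccontr)
    assume "z \<notin> D"
    then have "D \<subset> C" using D(2) f by (auto simp: T_def)
    then show False using circuit_minimal[OF C D(1)] D(3) by blast
  qed
  define A where "A = D - {z}"
  have A: "insert z A = D" "A \<subset> C" "f \<notin> A" using D(2) zD z f by (auto simp: A_def T_def)
  have zA: "z \<notin> A" by (simp add: A_def)
  show ?thesis
  proof (cases "e \<in> A")
    case True
    then show ?thesis using A D(1) by blast
  next
    case False
    \<comment> \<open>If \<open>A\<close> misses \<open>e\<close> as well, the opposite side with
      \<open>z\<close> is a circuit through \<open>e\<close> and \<open>f\<close>. Its size forces
      \<open>A\<close> to be a single element, parallel to \<open>z\<close>.\<close>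
    have big: "3 \<le> card (insert z A)" using simple_card_ge_3[OF simple D(1,3)] A(1) by simp
    have finA: "finite A" using A(2) finite_C by (auto intro: finite_subset)
    have cZ: "insert z (C - A) \<in> Z"
      using z A D(1) by (intro insert_complement_in_Z[OF C]) auto
    have "circuit M (insert z (C - A))"
    proof (rule circuit_insert[OF C])
      have "A \<noteq> {}" using big by auto
      then show "C - A \<subset> C" using A(2) by blast
      show "C - A \<noteq> {}" using e False by blast
      show "z \<notin> C" using z by simp
    qed (rule cZ)
    then have "card (insert z (C - A)) = card C"
      using e f False A(3) by (intro card_circuit_through_pair) auto
    then have "Suc (card (C - A)) = card C" using z finite_C by simp
    moreover have "card C = card A + card (C - A)"
      using finite_C A(2) finA by (metis card_Diff_subset card_mono le_add_diff_inverse psubset_imp_subset)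
    ultimately have "card A = 1" by simp
    then show ?thesis using big zA finA by simp
  qed
qed

definition chord :: "'e \<Rightarrow> 'e set" where
  "chord z = (SOME A. A \<subseteq> C \<and> e \<in> A \<and> f \<notin> A \<and> insert z A \<in> Z)"

lemma chord:
  assumes "z \<in> ground M - C"
  shows "chord z \<subseteq> C" "e \<in> chord z" "f \<notin> chord z" "insert z (chord z) \<in> Z"
  using someI_ex[OF chord_exists[OF assms, unfolded Bex_def]] unfolding chord_def by blast+

lemma chord_psubset: "z \<in> ground M - C \<Longrightarrow> chord z \<subset> C"
  using chord(1,3) f by blast

lemma chord_inj: "inj_on chord (ground M - C)"
proof (rule inj_onI, rule ccontr)
  fix z w assume zw: "z \<in> ground M - C" "w \<in> ground M - C" "chord z = chord w" "z \<noteq> w"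
  have "sym_diff (insert z (chord z)) (insert w (chord w)) = {z, w}"
    using zw chord(1)[OF zw(1)] by auto
  then have "{z, w} \<in> Z" using Z_sym_diff[OF chord(4)[OF zw(1)] chord(4)[OF zw(2)]] by simp
  then show False using simple_card_ge_3[OF simple, of "{z, w}"] zw(4) by simp
qed

text \<open>In the excluded cases \<open>z\<close> would be parallel to \<open>e\<close> or to
  \<open>f\<close>.\<close>

lemma chord_nontrivial:
  assumes z: "z \<in> ground M - C"
  shows "chord z \<noteq> {e}" "chord z \<noteq> C - {f}"
proof -
  have "z \<noteq> e" "z \<noteq> f" using z e f by auto
  then have ez: "card {z, e} = 2" "card {z, f} = 2" by simp_all
  show "chord z \<noteq> {e}" using simple_card_ge_3[OF simple chord(4)[OF z]] ez by auto
  have "insert z (C - chord z) \<in> Z"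
    using z chord[OF z] by (intro insert_complement_in_Z[OF C]) auto
  then have "3 \<le> card (insert z (C - chord z))" using simple_card_ge_3[OF simple] by blast
  moreover have "C - (C - {f}) = {f}" using f by blast
  ultimately show "chord z \<noteq> C - {f}" using ez by auto
qed

text \<open>The sum of both chord circuits and \<open>C\<close> is a circuit through
  \<open>e\<close> and \<open>f\<close>. Comparing its size with \<open>C\<close> leaves two
  elements for the symmetric difference, one on each side.\<close>

lemma chord_pair:
  assumes z: "z \<in> ground M - C" and w: "w \<in> ground M - C"
  shows "chord z \<subseteq> chord w \<or> chord w \<subseteq> chord z \<or>
    (\<exists>a b. chord z - chord w = {a} \<and> chord w - chord z = {b})"
proof (rule ccontr)
  assume no: "\<not> ?thesis"
  define P where "P = chord z"
  define Q where "Q = chord w"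
  note P = chord[OF z, folded P_def]
  note Q = chord[OF w, folded Q_def]
  have sub: "\<not> P \<subseteq> Q" "\<not> Q \<subseteq> P" using no by (auto simp: P_def Q_def)
  then have zw: "z \<noteq> w" by (auto simp: P_def Q_def)
  define D where "D = {z, w} \<union> (C - sym_diff P Q)"
  have "D = sym_diff (sym_diff (insert z P) (insert w Q)) C"
    unfolding D_def using z w zw P(1) Q(1) by auto
  then have DZ: "D \<in> Z" using P(4) Q(4) circuit_in_Z[OF C] by (simp add: Z_sym_diff)
  have "circuit M D"
    unfolding circuit_iff
  proof (intro conjI ballI impI)
    show "D \<noteq> {}" by (simp add: D_def)
    fix D' assume D': "D' \<in> Z" "D' \<subset> D"
    \<comment> \<open>A member \<open>D'\<close> with just one of the chords, \<open>u\<close>,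
      becomes a subset of \<open>C\<close> after adding \<open>insert u R\<close>. It would have to
      be empty or \<open>C\<close>, but \<open>D'\<close> avoids both \<open>R - R'\<close> and
      \<open>R' - R\<close>, which are nonempty.\<close>
    have key: False
      if "u \<in> D'" "u' \<notin> D'" and u: "{u, u'} = {z, w}" "u \<noteq> u'" "insert u R \<in> Z" "R \<subseteq> C" "\<not> R \<subseteq> R'" "\<not> R' \<subseteq> R"
        "sym_diff P Q = sym_diff R R'" "R' \<subseteq> C" for u u' R R'
    proof -
      have uC: "u \<notin> C" using u(1) z w by auto
      have DC: "D' - {u} \<subseteq> C - sym_diff R R'" using D'(2) that(1,2) u(1,7) unfolding D_def by auto
      have "sym_diff D' (insert u R) \<in> Z" using Z_sym_diff[OF D'(1) u(3)] .
      moreover have "sym_diff D' (insert u R) = sym_diff (D' - {u}) R"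
        using that(1) uC u(4) by auto
      moreover have sub_C: "sym_diff (D' - {u}) R \<subseteq> C" using DC u(4) by blast
      ultimately have "sym_diff (D' - {u}) R = {} \<or> sym_diff (D' - {u}) R = C"
        using circuit_minimal[OF C, of "sym_diff (D' - {u}) R"] sub_C by simp
      then show False using DC u(4-6,8) by blast
    qed
    consider "z \<in> D'" "w \<in> D'" | "z \<in> D'" "w \<notin> D'" | "z \<notin> D'" "w \<in> D'" | "z \<notin> D'" "w \<notin> D'" by blast
    then show "D' = {}"
    proof cases
      case 1
      have "sym_diff D' D \<subset> C" using 1 D'(2) sub P(1) unfolding D_def by blast
      then have "sym_diff D' D = {}" using circuit_minimal[OF C Z_sym_diff[OF D'(1) DZ]] by blast
      then show ?thesis using D'(2) by blast
    next
      case 2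
      then show ?thesis using key[of z w P Q] zw P(1,4) Q(1) sub by blast
    next
      case 3
      then show ?thesis using key[of w z Q P] zw P(1) Q(1,4) sub by blast
    next
      case 4
      then have "D' \<subset> C" using D'(2) sub P(1) unfolding D_def by blast
      then show ?thesis using circuit_minimal[OF C D'(1)] by blast
    qed
  qed (rule DZ)
  then have "card D = card C"
    using e f P(2,3) Q(2,3) by (intro card_circuit_through_pair) (auto simp: D_def)
  moreover have "card D = 2 + card (C - sym_diff P Q)"
    unfolding D_def using z w zw finite_C by (subst card_Un_disjoint) auto
  moreover have "sym_diff P Q \<subseteq> C" using P(1) Q(1) by blast
  then have "card C = card (sym_diff P Q) + card (C - sym_diff P Q)"
    using finite_C by (metis card_Diff_subset card_mono finite_subset le_add_diff_inverse)
  ultimately have two: "card (sym_diff P Q) = 2" by simp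
  have fin: "finite (P - Q)" "finite (Q - P)" using finite_C P(1) Q(1) by (auto intro: finite_subset)
  then have "card (sym_diff P Q) = card (P - Q) + card (Q - P)" by (intro card_Un_disjoint) auto
  moreover have "card (P - Q) \<noteq> 0" "card (Q - P) \<noteq> 0" using sub fin by auto
  ultimately have "card (P - Q) = 1" "card (Q - P) = 1" using two by auto
  then obtain a b where "P - Q = {a}" "Q - P = {b}" by (metis card_1_singletonE)
  then show False using no unfolding P_def Q_def by blast
qed

text \<open>Three sets that pairwise differ by one exchange either add one private element each to a
  common core or omit one private element each from a common union. \<open>no_fano\<close> applies
  to the sets or to their complements in \<open>C\<close>.\<close>

lemma chord_triple:
  assumes z: "z1 \<in> ground M - C" "z2 \<in> ground M - C" "z3 \<in> ground M - C"
    and card: "card (chord z1) = card (chord z2)" "card (chord z1) = card (chord z3)"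
  shows "z1 = z2 \<or> z1 = z3 \<or> z2 = z3"
proof (rule ccontr)
  assume no: "\<not> ?thesis"
  define X where "X = chord z1"
  define Y where "Y = chord z2"
  define W where "W = chord z3"
  note X = chord[OF z(1), folded X_def]
  note Y = chord[OF z(2), folded Y_def]
  note W = chord[OF z(3), folded W_def]
  have swap: "\<exists>a b. chord u - chord v = {a} \<and> chord v - chord u = {b}"
    if "u \<in> ground M - C" "v \<in> ground M - C" "card (chord u) = card (chord v)" "u \<noteq> v" for u v
  proof -
    have "finite (chord u)" "finite (chord v)"
      using chord(1)[OF that(1)] chord(1)[OF that(2)] finite_C by (auto intro: finite_subset)
    then have "\<not> chord u \<subseteq> chord v" "\<not> chord v \<subseteq> chord u"
      using that card_subset_eq inj_onD[OF chord_inj] by metis+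
    then show ?thesis using chord_pair[OF that(1,2)] by blast
  qed
  obtain a b where ab: "X - Y = {a}" "Y - X = {b}"
    using swap[OF z(1,2) card(1)] no by (auto simp: X_def Y_def)
  obtain c d where cd: "X - W = {c}" "W - X = {d}"
    using swap[OF z(1,3) card(2)] no by (auto simp: X_def W_def)
  obtain g h where gh: "Y - W = {g}" "W - Y = {h}"
    using swap[OF z(2,3)] card no by (auto simp: Y_def W_def)
  have sub: "X \<subset> C" "Y \<subset> C" "W \<subset> C" using chord_psubset z by (simp_all add: X_def Y_def W_def)
  have zC: "z1 \<notin> C" "z2 \<notin> C" "z3 \<notin> C" "distinct [z1, z2, z3]" using z no by auto
  have mem: "a \<in> X" "a \<notin> Y" "b \<in> Y" "b \<notin> X" "c \<in> X" "c \<notin> W" "d \<in> W" "d \<notin> X"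
    "g \<in> Y" "g \<notin> W" "h \<in> W" "h \<notin> Y"
    using ab cd gh by auto
  have unique: "x \<in> X \<Longrightarrow> x \<notin> Y \<Longrightarrow> x = a" "x \<in> Y \<Longrightarrow> x \<notin> X \<Longrightarrow> x = b"
    "x \<in> X \<Longrightarrow> x \<notin> W \<Longrightarrow> x = c" "x \<in> W \<Longrightarrow> x \<notin> X \<Longrightarrow> x = d"
    "x \<in> Y \<Longrightarrow> x \<notin> W \<Longrightarrow> x = g" for x
    using ab cd gh by auto
  show False
  \<comment> \<open>If \<open>a\<close> is private to \<open>X\<close>, the sets have private
    elements and share \<open>e\<close>. Otherwise the complements have private elements and share
    \<open>f\<close>.\<close>
  proof (cases "a \<in> W")
    case False
    have "b \<notin> W"
    proof
      assume "b \<in> W"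
      then have "b = d" using unique(4) mem(4) by simp
      then have "d \<in> Y" using mem(3) by simp
      show False
      proof (cases "h \<in> X")
        case True
        then show False using unique(1)[of h] mem(11,12) False by simp
      next
        case h: False
        then show False using unique(4)[of h] mem(11,12) \<open>d \<in> Y\<close> by simp
      qed
    qed
    moreover have "d \<notin> Y" using unique(2)[of d] mem calculation by auto
    ultimately have "a \<in> X - Y - W" "b \<in> Y - X - W" "d \<in> W - X - Y" "e \<in> X \<inter> Y \<inter> W"
      using False mem X(2) Y(2) W(2) by simp_all
    then show False by (rule no_fano[OF C sub zC X(4) Y(4) W(4)])
  next
    case True
    have cY: "c \<in> Y" using unique(1)[of c] mem True by auto
    have bW: "b \<in> W" using unique(5)[of b] unique(5)[of c] mem cY by auto
    have "b \<in> (C - X) - (C - Y) - (C - W)" "a \<in> (C - Y) - (C - X) - (C - W)"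
      "c \<in> (C - W) - (C - X) - (C - Y)" "f \<in> (C - X) \<inter> (C - Y) \<inter> (C - W)"
      using True cY bW mem f X(1,3) Y(1,3) W(1,3) by auto
    moreover have "insert z1 (C - X) \<in> Z" "insert z2 (C - Y) \<in> Z" "insert z3 (C - W) \<in> Z"
      using insert_complement_in_Z[OF C X(1) zC(1) X(4)] insert_complement_in_Z[OF C Y(1) zC(2) Y(4)]
        insert_complement_in_Z[OF C W(1) zC(3) W(4)] by simp_all
    moreover have "C - X \<subset> C" "C - Y \<subset> C" "C - W \<subset> C" using e X(2) Y(2) W(2) by auto
    ultimately show False
      using no_fano[OF C, of "C - X" "C - Y" "C - W" z1 z2 z3 b a c f] zC by simp
  qed
qed

text \<open>Drops the common element \<open>e\<close>, so that the sets live on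
  \<open>C - {e, f}\<close>, which is the set to be enumerated.\<close>

definition trim :: "'e \<Rightarrow> 'e set" where
  "trim z = chord z - {e}"

lemma chord_eq: "z \<in> ground M - C \<Longrightarrow> chord z = insert e (trim z)"
  using chord(2)[of z] by (auto simp: trim_def)

lemma trim_inj: "inj_on trim (ground M - C)"
proof (rule inj_onI)
  fix z w assume zw: "z \<in> ground M - C" "w \<in> ground M - C" "trim z = trim w"
  then have "chord z = chord w" by (simp add: chord_eq)
  then show "z = w" using inj_onD[OF chord_inj] zw(1,2) by blast
qed

lemma trim_subset: "z \<in> ground M - C \<Longrightarrow> trim z \<subseteq> C - {e, f}"
  using chord(1,3)[of z] by (auto simp: trim_def)

lemma trim_pair:
  assumes "X \<in> trim ` (ground M - C)" "Y \<in> trim ` (ground M - C)"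
  shows "X \<subseteq> Y \<or> Y \<subseteq> X \<or> (\<exists>a b. X - Y = {a} \<and> Y - X = {b})"
proof -
  obtain z w where zw: "z \<in> ground M - C" "w \<in> ground M - C" "X = trim z" "Y = trim w"
    using assms by blast
  have "X - Y = chord z - chord w" "Y - X = chord w - chord z"
    using chord(2)[OF zw(1)] chord(2)[OF zw(2)] by (auto simp: zw(3,4) trim_def)
  then show ?thesis using chord_pair[OF zw(1,2)] by (metis Diff_eq_empty_iff)
qed

lemma trim_triple:
  assumes "X \<in> trim ` (ground M - C)" "Y \<in> trim ` (ground M - C)" "W \<in> trim ` (ground M - C)"
    and "card X = card Y" "card X = card W"
  shows "X = Y \<or> X = W \<or> Y = W"
proof -
  have card_chord: "card (chord z) = Suc (card (trim z))" if "z \<in> ground M - C" for z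
  proof -
    have "finite (trim z)" using trim_subset[OF that] finite_C by (auto intro: finite_subset)
    moreover have "e \<notin> trim z" by (simp add: trim_def)
    ultimately show ?thesis using chord_eq[OF that] by simp
  qed
  obtain x y w where xyw: "x \<in> ground M - C" "y \<in> ground M - C" "w \<in> ground M - C"
    "X = trim x" "Y = trim y" "W = trim w" using assms(1-3) by blast
  then have "x = y \<or> x = w \<or> y = w"
    using assms(4,5) by (intro chord_triple) (simp_all add: card_chord)
  then show ?thesis using xyw by auto
qed

lemma trim_enumeration:
  obtains xs where "distinct xs" "set xs = C - {e, f}"
    "\<And>A. A \<in> trim ` (ground M - C) \<Longrightarrow> A = set (take (card A) xs) \<or>
      (0 < card A \<and> card A < length xs \<and> set (take (card A) xs) \<in> trim ` (ground M - C) \<and>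
       A = insert (xs ! card A) (set (take (card A - 1) xs)))"
proof (rule two_per_level_enumeration)
  show "finite (C - {e, f})" using finite_C by simp
  show "A \<subseteq> C - {e, f}" if "A \<in> trim ` (ground M - C)" for A using that trim_subset by blast
qed (rule trim_pair trim_triple that; assumption)+

text \<open>Modulo the circuits \<open>insert z (chord z)\<close>, every cycle is a subset of the spanning circuit
  \<open>C\<close>, and \<open>C\<close> has only two subsets that are cycles.\<close>

lemma cycle_transfer:
  fixes \<psi> :: "'e \<Rightarrow> nat"
  assumes inj: "inj_on \<psi> (ground M)"
    and \<psi>C: "ladder_even (\<psi> ` C)" "\<And>D. D \<subseteq> \<psi> ` C \<Longrightarrow> ladder_even D \<Longrightarrow> D = {} \<or> D = \<psi> ` C"
    and chords: "\<And>z. z \<in> ground M - C \<Longrightarrow> ladder_even (\<psi> ` insert z (chord z))"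
    and D: "D \<subseteq> ground M"
  shows "D \<in> Z \<longleftrightarrow> ladder_even (\<psi> ` D)"
  using D
proof (induction "card (D - C)" arbitrary: D)
  case 0
  have CM: "C \<subseteq> ground M" using C by (simp add: circuit_def)
  have "finite (D - C)" using 0(2) finite_ground by (auto intro: finite_subset)
  then have DC: "D \<subseteq> C" using 0(1) by simp
  have empty: "{} \<in> Z" using Z_sym_diff[OF circuit_in_Z[OF C] circuit_in_Z[OF C]] by simp
  have "D = C" if "\<psi> ` D = \<psi> ` C"
    using that inj_on_image_eq_iff[OF inj 0(2) CM] by simp
  moreover have "\<psi> ` D \<subseteq> \<psi> ` C" using DC by blast
  ultimately have "ladder_even (\<psi> ` D) \<longleftrightarrow> D = {} \<or> D = C"
    using \<psi>C(1) \<psi>C(2)[of "\<psi> ` D"] ladder_even_empty by auto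
  moreover have "D \<in> Z \<longleftrightarrow> D = {} \<or> D = C"
    using circuit_minimal[OF C _ DC] empty circuit_in_Z[OF C] by blast
  ultimately show ?case by simp
next
  case (Suc n)
  have fin: "finite D" using Suc.prems finite_ground by (rule finite_subset)
  obtain z where z: "z \<in> D - C" using Suc.hyps(2) by (cases "D - C = {}") auto
  then have zM: "z \<in> ground M - C" using Suc.prems by blast
  \<comment> \<open>Adding \<open>T\<close> removes the chord \<open>z\<close> from \<open>D\<close>
    and brings in no other chord. Both sides of the equivalence are stable under this, so the number
    of chords decreases.\<close>
  define T where "T = insert z (chord z)"
  have T: "T \<in> Z" "ladder_even (\<psi> ` T)" using chord(4)[OF zM] chords[OF zM] by (simp_all add: T_def)
  have TM: "T \<subseteq> ground M" by (rule Z_subset[OF T(1)])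
  have finT: "finite T" using TM finite_ground by (rule finite_subset)
  define D' where "D' = sym_diff D T"
  have D'M: "D' \<subseteq> ground M" using Suc.prems TM by (auto simp: D'_def)
  have "D' - C = (D - C) - {z}" using z chord(1)[OF zM] by (auto simp: D'_def T_def)
  then have "card (D' - C) = n" using Suc.hyps(2) z fin by simp
  then have IH: "D' \<in> Z \<longleftrightarrow> ladder_even (\<psi> ` D')" using Suc.hyps(1)[OF _ D'M] by simp
  have D_back: "sym_diff D' T = D" by (auto simp: D'_def)
  have image: "\<psi> ` sym_diff X Y = sym_diff (\<psi> ` X) (\<psi> ` Y)" if "X \<subseteq> ground M" "Y \<subseteq> ground M" for X Y
  proof -
    have "X - Y \<subseteq> ground M" "Y - X \<subseteq> ground M" using that by blast+
    then show ?thesis using inj_on_image_set_diff[OF inj] that by (simp only: image_Un)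
  qed
  have finD': "finite D'" using fin finT by (simp add: D'_def)
  have "D \<in> Z \<longleftrightarrow> D' \<in> Z"
  proof
    show "D' \<in> Z" if "D \<in> Z" unfolding D'_def using that T(1) by (rule Z_sym_diff)
    show "D \<in> Z" if "D' \<in> Z" using Z_sym_diff[OF that T(1)] unfolding D_back .
  qed
  moreover have "ladder_even (\<psi> ` D) \<longleftrightarrow> ladder_even (\<psi> ` D')"
  proof
    assume "ladder_even (\<psi> ` D)"
    then show "ladder_even (\<psi> ` D')"
      unfolding D'_def image[OF Suc.prems TM] using T(2) fin finT by (intro ladder_even_sym_diff) auto
  next
    assume "ladder_even (\<psi> ` D')"
    then have "ladder_even (sym_diff (\<psi> ` D') (\<psi> ` T))"
      using T(2) finD' finT by (intro ladder_even_sym_diff) auto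
    then show "ladder_even (\<psi> ` D)" unfolding image[OF D'M TM, symmetric] D_back .
  qed
  ultimately show ?case using IH by simp
qed

lemma clean_ladder_exists:
  "\<exists>L :: (nat, nat) pre_graph. clean_ladder L \<and> matroid_iso M (cycle_matroid L)"
proof -

  \<comment> \<open>Enumeration of the circuit and levels of the chords\<close>
  define G where "G = ground M - C"
  define \<A> where "\<A> = trim ` G"
  obtain xs where xs: "distinct xs" "set xs = C - {e, f}" and
    levels: "\<And>A. A \<in> \<A> \<Longrightarrow> A = set (take (card A) xs) \<or>
      (0 < card A \<and> card A < length xs \<and> set (take (card A) xs) \<in> \<A> \<and>
       A = insert (xs ! card A) (set (take (card A - 1) xs)))"
    using trim_enumeration unfolding \<A>_def G_def by blast
  define m where "m = length xs"
  have CM: "C \<subseteq> ground M" using C by (simp add: circuit_def)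
  have C_eq: "C = insert e (insert f (set xs))" using xs(2) e f by auto
  have m: "0 < m"
  proof (rule ccontr)
    assume "\<not> 0 < m"
    then have "C = {e, f}" using C_eq by (simp add: m_def)
    then have "card C \<le> 2" by (simp add: card_insert_if)
    moreover have "3 \<le> card C" using simple C by (simp add: simple_matroid_def)
    ultimately show False by simp
  qed
  \<comment> \<open>\<open>P j\<close> and \<open>T i\<close> are the two possible shapes of a
    trimmed chord, of sizes \<open>j\<close> and \<open>i + 1\<close>.\<close>
  define P where "P j = set (take j xs)" for j
  define T where "T i = insert (xs ! Suc i) (P i)" for i
  have P_image: "P j = (!) xs ` {..<j}" if "j \<le> m" for j
    using that nth_image[of j xs] by (simp add: P_def m_def lessThan_atLeast0)
  have nth_P: "xs ! i \<in> P j \<longleftrightarrow> i < j" if "i < m" "j \<le> m" for i j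
    using that xs(1) unfolding P_image[OF that(2)] m_def by (auto simp: nth_eq_iff_index_eq)
  have card_P: "card (P j) = j" if "j \<le> m" for j
    using that xs(1) by (simp add: P_def m_def distinct_card)
  have card_T: "card (T i) = Suc i" if "Suc i < m" for i
    using that nth_P[of "Suc i" i] card_P[of i] by (simp add: T_def P_def)
  have T_P: "T i \<noteq> P (Suc i)" if "Suc i < m" for i
    using that nth_P[of "Suc i" "Suc i"] by (auto simp: T_def)
  define Zs where "Zs = {j. j \<le> m \<and> P j \<in> \<A>}"
  define W where "W = {i. Suc i < m \<and> T i \<in> \<A>}"
  \<comment> \<open>By simplicity: level 0 would give an element parallel to \<open>e\<close>, level
    \<open>m\<close> one parallel to \<open>f\<close>.\<close>
  have Zs: "0 < j" "j < m" if "j \<in> Zs" for j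
  proof -
    obtain z where z: "z \<in> G" "P j = trim z" using \<open>j \<in> Zs\<close> by (auto simp: Zs_def \<A>_def)
    have chord_z: "chord z = insert e (P j)" using chord_eq[of z] z by (simp add: G_def)
    show "0 < j"
      using chord_nontrivial(1)[of z] z(1) chord_z by (cases j) (auto simp: G_def P_def)
    have "insert e (P m) = C - {f}" using C_eq ef xs(2) by (auto simp: P_def m_def)
    then have "j \<noteq> m" using chord_nontrivial(2)[of z] z(1) chord_z by (auto simp: G_def)
    then show "j < m" using that by (simp add: Zs_def)
  qed
  have level_cases: "(\<exists>j\<in>Zs. A = P j) \<or> (\<exists>i\<in>W. Suc i \<in> Zs \<and> A = T i)" if A: "A \<in> \<A>" for A
  proof -
    have "A \<subseteq> set xs" using A trim_subset by (auto simp: \<A>_def G_def xs(2))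
    then have "card A \<le> m"
      using card_mono[of "set xs" A] distinct_card[OF xs(1)] by (simp add: m_def)
    consider "A = P (card A)"
      | "0 < card A" "card A < m" "P (card A) \<in> \<A>" "A = insert (xs ! card A) (P (card A - 1))"
      using levels[OF A] by (auto simp only: P_def m_def)
    then show ?thesis
    proof cases
      case 1
      then have "card A \<in> Zs" using A \<open>card A \<le> m\<close> by (simp add: Zs_def)
      then show ?thesis using 1 by blast
    next
      case 2
      then obtain i where i: "card A = Suc i" by (cases "card A") auto
      have "A = T i" using 2(4) unfolding i T_def by simp
      moreover have "i \<in> W" using A 2(2) i \<open>A = T i\<close> by (simp add: W_def)
      moreover have "Suc i \<in> Zs" using 2(2,3) i by (simp add: Zs_def)
      ultimately show ?thesis by blast
    qed
  qed
  have W_Zs: "W \<subseteq> {i. Suc i \<in> Zs}"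
  proof
    fix i assume i: "i \<in> W"
    then have im: "Suc i < m" "T i \<in> \<A>" by (simp_all add: W_def)
    show "i \<in> {i. Suc i \<in> Zs}"
      using level_cases[OF im(2)]
    proof (elim disjE bexE conjE)
      fix j assume j: "j \<in> Zs" "T i = P j"
      then have "j = Suc i" using card_T[OF im(1)] card_P[of j] Zs(2)[OF j(1)] by simp
      then show ?thesis using T_P[OF im(1)] j(2) by simp
    next
      fix k assume k: "k \<in> W" "Suc k \<in> Zs" "T i = T k"
      have km: "Suc k < m" using k(1) by (simp add: W_def)
      have "Suc i = card (T i)" by (rule card_T[OF im(1), symmetric])
      also have "\<dots> = card (T k)" by (rule arg_cong[OF k(3)])
      also have "\<dots> = Suc k" by (rule card_T[OF km])
      finally have "k = i" by simp
      then show ?thesis using k(2) by simp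
    qed
  qed
  \<comment> \<open>\<open>T (Suc i)\<close> has two elements outside \<open>T i\<close>, while
    \<open>T i\<close> has one outside \<open>T (Suc i)\<close>; this contradicts the exchange
    property.\<close>
  have W_gap: "Suc i \<notin> W" if "i \<in> W" for i
  proof
    assume "Suc i \<in> W"
    then have im: "Suc (Suc i) < m" "T (Suc i) \<in> \<A>" "T i \<in> \<A>" using that by (simp_all add: W_def)
    have "xs ! Suc i \<noteq> xs ! Suc (Suc i)" "xs ! i \<noteq> xs ! Suc i" "xs ! i \<noteq> xs ! Suc (Suc i)"
      using im(1) xs(1) by (simp_all add: nth_eq_iff_index_eq m_def)
    then have diff: "xs ! Suc i \<in> T i - T (Suc i)" "xs ! i \<in> T (Suc i) - T i"
        "xs ! Suc (Suc i) \<in> T (Suc i) - T i" "xs ! i \<noteq> xs ! Suc (Suc i)"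
      using im(1) nth_P[of "Suc i" "Suc i"] nth_P[of i "Suc i"] nth_P[of i i] nth_P[of "Suc (Suc i)" i]
      by (auto simp: T_def)
    have "T i \<subseteq> T (Suc i) \<or> T (Suc i) \<subseteq> T i \<or>
        (\<exists>a b. T i - T (Suc i) = {a} \<and> T (Suc i) - T i = {b})"
      using trim_pair im(2,3) unfolding \<A>_def G_def by simp
    then show False
    proof (elim disjE exE conjE)
      fix a b assume "T (Suc i) - T i = {b}"
      then show False using diff(2-4) by simp
    qed (use diff in blast)+
  qed
  define L where "L = ladder_graph {..m + 1} (insert (5 * m) (ladder_edges Zs W m))"
  have clean: "clean_ladder L"
    unfolding L_def using W_Zs W_gap Zs m by (intro clean_ladder_ladder_graph) auto

  \<comment> \<open>Labelling the ground set by ladder edges\<close>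
  define idx where "idx x = (SOME i. i < m \<and> xs ! i = x)" for x
  have idx: "idx (xs ! i) = i" if "i < m" for i
  proof -
    have "idx (xs ! i) < m \<and> xs ! idx (xs ! i) = xs ! i"
      using someI[of "\<lambda>k. k < m \<and> xs ! k = xs ! i" i] that unfolding idx_def by simp
    then show ?thesis using that nth_eq_iff_index_eq[OF xs(1), of "idx (xs ! i)" i] by (simp add: m_def)
  qed
  \<comment> \<open>A chord of the second shape has trimmed size \<open>i + 1\<close> and label
    \<open>5 * i + 4\<close>, hence the subtraction of 1.\<close>
  define \<psi> where "\<psi> x = (if x = e then 1 else if x = f then 5 * m else if x \<in> C then 5 * idx x + 3
    else if trim x = P (card (trim x)) then 5 * card (trim x) + 1 else 5 * (card (trim x) - 1) + 4)" for x
  have \<psi>_e: "\<psi> e = 1" and \<psi>_f: "\<psi> f = 5 * m" using ef by (simp_all add: \<psi>_def)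
  have \<psi>_xs: "\<psi> (xs ! i) = 5 * i + 3" if "i < m" for i
  proof -
    have "xs ! i \<in> C - {e, f}" unfolding xs(2)[symmetric] using that by (simp add: m_def)
    then show ?thesis using idx[OF that] by (simp add: \<psi>_def)
  qed
  have G_C: "z \<noteq> e" "z \<noteq> f" "z \<notin> C" if "z \<in> G" for z using that e f by (auto simp: G_def)
  have \<psi>_rung: "\<psi> z = 5 * j + 1" if "z \<in> G" "j \<in> Zs" "trim z = P j" for z j
    using G_C[OF that(1)] card_P[of j] Zs(2)[OF that(2)] unfolding \<psi>_def that(3) by simp
  have \<psi>_cross: "\<psi> z = 5 * i + 4" if "z \<in> G" "i \<in> W" "trim z = T i" for z i
  proof -
    have "Suc i < m" using that(2) by (simp add: W_def)
    then show ?thesis using G_C[OF that(1)] card_T[of i] T_P[of i] unfolding \<psi>_def that(3) by simp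
  qed
  have G_cases: "(\<exists>j\<in>Zs. trim z = P j) \<or> (\<exists>i\<in>W. trim z = T i)" if "z \<in> G" for z
    using level_cases[of "trim z"] that by (auto simp: \<A>_def)
  have set_xs: "set xs = (!) xs ` {..<m}" using P_image[of m] by (simp add: P_def m_def)
  have ground_eq: "ground M = insert e (insert f (set xs)) \<union> G" using C_eq CM by (auto simp: G_def)

  \<comment> \<open>A left inverse of \<psi>, read off from residues modulo 5. The label 1 is tested
    first, since it is \<open>e\<close> and not a rung; the only multiple of 5 in use is
    \<open>5 * m\<close>.\<close>
  define \<psi>' where "\<psi>' n = (if n = 1 then e else if n mod 5 = 0 then f else if n mod 5 = 3 then xs ! (n div 5)
    else if n mod 5 = 1 then inv_into G trim (P (n div 5)) else inv_into G trim (T (n div 5)))" for n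
  have \<psi>'_rung: "\<psi>' (5 * j + 1) = inv_into G trim (P j)" if "0 < j" for j
  proof -
    have "(5 * j + 1) div 5 = j" "(5 * j + 1) mod 5 = 1" by presburger+
    then show ?thesis using that unfolding \<psi>'_def by simp
  qed
  have "\<psi>' (\<psi> x) = x" if "x \<in> ground M" for x
  proof -
    consider "x = e" | "x = f" | i where "i < m" "x = xs ! i" | "x \<in> G"
      using \<open>x \<in> ground M\<close> unfolding ground_eq set_xs by auto
    then show ?thesis
    proof cases
      case 4
      have inv: "inv_into G trim (trim x) = x" using trim_inj 4 by (simp add: G_def inv_into_f_f)
      show ?thesis
        using G_cases[OF 4]
      proof (elim disjE bexE)
        fix j assume "j \<in> Zs" "trim x = P j"
        then show ?thesis using \<psi>_rung[OF 4] Zs(1)[of j] inv \<psi>'_rung[of j] by metis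
      next
        fix i assume "i \<in> W" "trim x = T i"
        then show ?thesis using \<psi>_cross[OF 4] inv by (simp add: \<psi>'_def)
      qed
    qed (use m in \<open>simp_all add: \<psi>'_def \<psi>_e \<psi>_f \<psi>_xs\<close>)
  qed
  then have inj: "inj_on \<psi> (ground M)" by (rule inj_on_inverseI)

  \<comment> \<open>Images of the circuit, the chords and the ground set\<close>
  have image_xs: "\<psi> ` P j = (\<lambda>i. 5 * i + 3) ` {..<j}" if "j \<le> m" for j
    unfolding P_image[OF that] image_image using that \<psi>_xs by (intro image_cong) auto
  have image_prefix: "\<psi> ` insert e (P j) = ladder_prefix j" if "j \<le> m" for j
    using image_xs[OF that] \<psi>_e by (simp add: ladder_prefix_def)
  have image_C: "\<psi> ` C = insert (5 * m) (ladder_prefix m)"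
  proof -
    have "C = insert f (insert e (P m))" using C_eq by (simp add: P_def m_def insert_commute)
    moreover have "\<psi> ` insert f (insert e (P m)) = insert (5 * m) (ladder_prefix m)"
      unfolding image_insert[of \<psi> f] \<psi>_f image_prefix[OF order_refl] ..
    ultimately show ?thesis by (rule ssubst)
  qed
  have image_G: "\<psi> ` G = (\<lambda>j. 5 * j + 1) ` {j \<in> Zs. j < m} \<union> (\<lambda>i. 5 * i + 4) ` {i \<in> W. Suc i < m}"
  proof (rule equalityI; rule subsetI)
    fix n assume "n \<in> \<psi> ` G"
    then obtain z where z: "z \<in> G" "n = \<psi> z" by blast
    show "n \<in> (\<lambda>j. 5 * j + 1) ` {j \<in> Zs. j < m} \<union> (\<lambda>i. 5 * i + 4) ` {i \<in> W. Suc i < m}"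
      using G_cases[OF z(1)]
    proof (elim disjE bexE)
      fix j assume "j \<in> Zs" "trim z = P j"
      then show ?thesis using \<psi>_rung[OF z(1)] z(2) Zs(2) by auto
    next
      fix i assume "i \<in> W" "trim z = T i"
      then show ?thesis using \<psi>_cross[OF z(1)] z(2) by (auto simp: W_def)
    qed
  next
    fix n assume "n \<in> (\<lambda>j. 5 * j + 1) ` {j \<in> Zs. j < m} \<union> (\<lambda>i. 5 * i + 4) ` {i \<in> W. Suc i < m}"
    then consider j where "j \<in> Zs" "n = 5 * j + 1" | i where "i \<in> W" "n = 5 * i + 4" by blast
    then show "n \<in> \<psi> ` G"
    proof cases
      case (1 j)
      then obtain z where "z \<in> G" "trim z = P j" by (auto simp: Zs_def \<A>_def)
      then show ?thesis using \<psi>_rung[of z j] 1 by (metis imageI)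
    next
      case (2 i)
      then obtain z where "z \<in> G" "trim z = T i" by (auto simp: W_def \<A>_def)
      then show ?thesis using \<psi>_cross[of z i] 2 by (metis imageI)
    qed
  qed
  have "ground M = C \<union> G" using CM by (auto simp: G_def)
  then have image_M: "\<psi> ` ground M = edges L"
    using image_C image_G by (simp add: L_def image_Un ladder_edges_def ladder_prefix_def Un_assoc)
  have "ladder_even (\<psi> ` insert z (chord z))" if "z \<in> ground M - C" for z
  proof -
    have z: "z \<in> G" using that by (simp add: G_def)
    have chord_z: "chord z = insert e (trim z)" by (rule chord_eq[OF that])
    show ?thesis
      using G_cases[OF z]
    proof (elim disjE bexE)
      fix j assume j: "j \<in> Zs" "trim z = P j"
      have "\<psi> ` insert z (chord z) = insert (5 * j + 1) (ladder_prefix j)"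
        unfolding chord_z j(2) image_insert[of \<psi> z] \<psi>_rung[OF z j]
        using image_prefix[of j] Zs(2)[OF j(1)] by simp
      then show ?thesis using ladder_even_rung[OF Zs(1)[OF j(1)]] by simp
    next
      fix i assume i: "i \<in> W" "trim z = T i"
      then have im: "Suc i < m" by (simp add: W_def)
      have "insert z (chord z) = insert z (insert (xs ! Suc i) (insert e (P i)))"
        unfolding chord_z i(2) T_def by blast
      then have "\<psi> ` insert z (chord z) = insert (5 * i + 4) (insert (5 * Suc i + 3) (ladder_prefix i))"
        using image_prefix[of i] im \<psi>_cross[OF z i] \<psi>_xs[OF im] by simp
      then show ?thesis using ladder_even_cross by metis
    qed
  qed
  moreover have "ladder_even (\<psi> ` C)" unfolding image_C by (rule ladder_even_hamiltonian[OF m])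
  moreover have "D = {} \<or> D = \<psi> ` C" if "D \<subseteq> \<psi> ` C" "ladder_even D" for D
    using ladder_even_subset_hamiltonian[OF _ that(2) m] that(1) unfolding image_C by blast
  ultimately have transfer: "D \<in> Z \<longleftrightarrow> ladder_even (\<psi> ` D)" if "D \<subseteq> ground M" for D
    using cycle_transfer[OF inj _ _ _ that] by blast

  \<comment> \<open>The isomorphism\<close>
  have "matroid_iso M (cycle_matroid L)"
    unfolding matroid_iso_def
  proof (intro exI[of _ \<psi>] conjI allI impI)
    show "bij_betw \<psi> (ground M) (ground (cycle_matroid L))"
      using inj image_M by (simp add: bij_betw_def cycle_matroid_def)
    fix X assume X: "X \<subseteq> ground M"
    have L: "graph L" "\<And>x. x \<in> edges L \<Longrightarrow> card (ends L x) = 2"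
      using clean by (simp_all add: clean_ladder_def L_def card_ladder_ends)
    have XL: "\<psi> ` X \<subseteq> edges L" using X image_M by blast
    have even_L: "D \<in> even_sets L \<longleftrightarrow> D \<subseteq> edges L \<and> ladder_even D" for D
      unfolding L_def even_sets_ladder_graph by simp
    \<comment> \<open>Independence on either side means avoiding the nonempty members of a binary
      family, and \<psi> matches the two families.\<close>
    have "(\<forall>D\<in>Z. D \<subseteq> X \<longrightarrow> D = {}) \<longleftrightarrow> (\<forall>D\<in>even_sets L. D \<subseteq> \<psi> ` X \<longrightarrow> D = {})"
    proof (intro iffI ballI impI)
      fix D assume no: "\<forall>D\<in>Z. D \<subseteq> X \<longrightarrow> D = {}" and D: "D \<in> even_sets L" "D \<subseteq> \<psi> ` X"
      then obtain D' where D': "D' \<subseteq> X" "D = \<psi> ` D'" by (meson subset_imageE)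
      have "D' \<in> Z" using D(1) D' X transfer[of D'] unfolding even_L by blast
      then show "D = {}" using no D' by blast
    next
      fix D assume no: "\<forall>D\<in>even_sets L. D \<subseteq> \<psi> ` X \<longrightarrow> D = {}" and D: "D \<in> Z" "D \<subseteq> X"
      then have "ladder_even (\<psi> ` D)" using X transfer[of D] by blast
      then have even: "\<psi> ` D \<in> even_sets L" unfolding even_L using D(2) XL by blast
      have "\<psi> ` D = {}" by (rule no[THEN bspec, THEN mp, OF even image_mono[OF D(2)]])
      then show "D = {}" by simp
    qed
    then show "indep M X \<longleftrightarrow> indep (cycle_matroid L) (\<psi> ` X)"
      using indep_cycle_matroid_iff[OF L(1) _ XL] L(2) unfolding indep_iff[OF X] by simp
  qed
  then show ?thesis using clean by blast
qed

end

theorem corollary1p4: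
  fixes M :: "'e pre_matroid" and e f :: 'e
  assumes "matroid M"
    and "simple_matroid M"
    and "connected_matroid M"
    and "regular_matroid M"
    and "e \<in> ground M" and "f \<in> ground M" and "e \<noteq> f"
    and "\<And>C. circuit M C \<Longrightarrow> e \<in> C \<Longrightarrow> f \<in> C \<Longrightarrow> spanning M C"
  shows "\<exists>L :: (nat, nat) pre_graph. clean_ladder L \<and> matroid_iso M (cycle_matroid L)"
proof -
  obtain C where C: "circuit M C" "e \<in> C" "f \<in> C"
    using assms(3,5-7) unfolding connected_matroid_def by blast
  obtain A :: "nat \<Rightarrow> 'e \<Rightarrow> bit" where
    A: "\<And>X. X \<subseteq> ground M \<Longrightarrow> indep M X \<longleftrightarrow> lin_indep A X"
    using regular_matroid_lin_indep[OF assms(1,4)] by blast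
  obtain B :: "nat \<Rightarrow> 'e \<Rightarrow> rat" where
    B: "\<And>X. X \<subseteq> ground M \<Longrightarrow> indep M X \<longleftrightarrow> lin_indep B X"
    using regular_matroid_lin_indep[OF assms(1,4)] by blast
  interpret matroid M by fact
  interpret spanning_pair M "cycle_space (ground M) A" B e f C
  proof unfold_locales
    show "D \<subseteq> ground M" if "D \<in> cycle_space (ground M) A" for D
      using that by (rule cycle_space_subset)
    show "sym_diff D D' \<in> cycle_space (ground M) A"
      if "D \<in> cycle_space (ground M) A" "D' \<in> cycle_space (ground M) A" for D D'
      using finite_ground that by (rule cycle_space_sym_diff)
    show "indep M X \<longleftrightarrow> (\<forall>D\<in>cycle_space (ground M) A. D \<subseteq> X \<longrightarrow> D = {})" if "X \<subseteq> ground M" for X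
      unfolding A[OF that] by (rule lin_indep_bit_iff[OF finite_ground that])
    show "indep M X \<longleftrightarrow> lin_indep B X" if "X \<subseteq> ground M" for X
      by (rule B[OF that])
    show "spanning M D" if "circuit M D" "e \<in> D" "f \<in> D" for D
      using that by (rule assms(8))
  qed (fact assms C)+
  show ?thesis by (rule clean_ladder_exists)
qed

end
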